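(* Let $X$ be a complex Banach space and let $T\in\mathcal{B}(X)$ be a power-bounded operator such that $\sigma(T)\cap\mathbb{T}=\{1\}$. Let $m:(0,\pi]\to(0,\infty)$ be a continuous decreasing function such that $\|R(\mathrm{e}^{\mathrm{i}\theta},T)\|\leq m(|\theta|)$ for all $\theta$ with $0<|\theta|\leq\pi$, and define $m_{\log}:(0,\pi]\to(0,\infty)$ by $$m_{\log}(\theta):=m(\theta)\log\left(1+\frac{m(\theta)}{\theta}\right).$$ Then, for any $c\in(0,1)$, $\|T^n(I-T)\|=O\big(m_{\log}^{-1}(cn)\big)$ as $n\to\infty$.
   Context: $T$ is power-bounded if $\sup_{n\geq0}\|T^n\|<\infty$; $\mathbb{T}$ is the unit circle; $R(\lambda,T)=(\lambda-T)^{-1}$. The function $m_{\log}$ is strictly decreasing and $m_{\log}^{-1}$ denotes its inverse, defined on the range of $m_{\log}$. *)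

theory Defs
  imports "HOL-Analysis.Analysis" "HOL-Library.Landau_Symbols"
begin

text \<open>HOL has no class of complex vector spaces. A complex Banach space is modelled as a
  real Banach space together with a bounded operator J (multiplication by i) such that
  J (J x) = -x and the induced complex scalar multiplication is absolutely homogeneous.\<close>

definition cscale :: "('a::real_normed_vector \<Rightarrow>\<^sub>L 'a) \<Rightarrow> complex \<Rightarrow> 'a \<Rightarrow> 'a" where
  "cscale J z x = Re z *\<^sub>R x + Im z *\<^sub>R blinfun_apply J x"

definition complex_structure :: "('a::real_normed_vector \<Rightarrow>\<^sub>L 'a) \<Rightarrow> bool" where
  "complex_structure J \<longleftrightarrow> (\<forall>x. blinfun_apply J (blinfun_apply J x) = - x) \<and>
     (\<forall>z x. norm (cscale J z x) = cmod z * norm x)"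

definition clinear_op :: "('a::real_normed_vector \<Rightarrow>\<^sub>L 'a) \<Rightarrow> ('a \<Rightarrow>\<^sub>L 'a) \<Rightarrow> bool" where
  "clinear_op J T \<longleftrightarrow> T o\<^sub>L J = J o\<^sub>L T"

definition cscaleL :: "('a::real_normed_vector \<Rightarrow>\<^sub>L 'a) \<Rightarrow> complex \<Rightarrow> ('a \<Rightarrow>\<^sub>L 'a)" where
  "cscaleL J z = Re z *\<^sub>R id_blinfun + Im z *\<^sub>R J"

definition op_invertible :: "('a::real_normed_vector \<Rightarrow>\<^sub>L 'a) \<Rightarrow> ('a \<Rightarrow>\<^sub>L 'a) \<Rightarrow> bool" where
  "op_invertible J A \<longleftrightarrow> (\<exists>S. clinear_op J S \<and> S o\<^sub>L A = id_blinfun \<and> A o\<^sub>L S = id_blinfun)"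

definition op_spectrum :: "('a::real_normed_vector \<Rightarrow>\<^sub>L 'a) \<Rightarrow> ('a \<Rightarrow>\<^sub>L 'a) \<Rightarrow> complex set" where
  "op_spectrum J T = {l. \<not> op_invertible J (cscaleL J l - T)}"

definition resolvent :: "('a::real_normed_vector \<Rightarrow>\<^sub>L 'a) \<Rightarrow> complex \<Rightarrow> ('a \<Rightarrow>\<^sub>L 'a) \<Rightarrow> ('a \<Rightarrow>\<^sub>L 'a)" where
  "resolvent J l T = (THE S. S o\<^sub>L (cscaleL J l - T) = id_blinfun \<and> (cscaleL J l - T) o\<^sub>L S = id_blinfun)"

definition op_pow :: "('a::real_normed_vector \<Rightarrow>\<^sub>L 'a) \<Rightarrow> nat \<Rightarrow> ('a \<Rightarrow>\<^sub>L 'a)" where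
  "op_pow T n = ((\<lambda>S. T o\<^sub>L S) ^^ n) id_blinfun"

definition power_bounded :: "('a::real_normed_vector \<Rightarrow>\<^sub>L 'a) \<Rightarrow> bool" where
  "power_bounded T \<longleftrightarrow> (\<exists>C. \<forall>n. norm (op_pow T n) \<le> C)"

definition m_log :: "(real \<Rightarrow> real) \<Rightarrow> real \<Rightarrow> real" where
  "m_log m \<theta> = m \<theta> * ln (1 + m \<theta> / \<theta>)"

text \<open>Inverse of the (strictly decreasing) function m_log on (0,pi], defined on its range.\<close>
definition m_log_inv :: "(real \<Rightarrow> real) \<Rightarrow> real \<Rightarrow> real" where
  "m_log_inv m y = (THE \<theta>. \<theta> \<in> {0<..pi} \<and> m_log m \<theta> = y)"

end

theory Submission
  imports Defs "HOL-Complex_Analysis.Cauchy_Integral_Formula"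
begin

text \<open>The proof is a contour argument in the style of Newman. Put \<open>d = m_log_inv m (c n)\<close>,
  \<open>M = m d\<close> and use the weight \<open>w(z) = (z - e\<^sup>i\<^sup>d)(z - e\<^sup>-\<^sup>i\<^sup>d)/(z - 1)\<^sup>2\<close>, which tends to 1 at
  infinity and vanishes at the two points of the unit circle at angle \<open>d\<close> from 1. Cauchy's theorem
  expresses \<open>T\<^sup>n(I - T)\<close> as the integral of \<open>w(z) T\<^sup>n(I - T)R(z,T)\<close> over a circle outside the
  unit disc. Near the angle 0, power-boundedness and the zeros of \<open>w\<close> bound the integral by
  a multiple of \<open>d\<close>. Away from it, move the contour to the unit circle and write
  \<open>T\<^sup>nR(z,T) = z\<^sup>nR(z,T) - P\<^sub>n(z)\<close> with a polynomial \<open>P\<^sub>n\<close>. The polynomial part is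
  moved into the disc, where it is estimated in the same way. The part with \<open>z\<^sup>n\<close> is moved to radius
  \<open>exp (-c/M)\<close>, where \<open>\<parallel>R(z,T)\<parallel> \<le> M/(1 - c)\<close> by perturbation from the circle, while
  \<open>\<bar>z\<bar>\<^sup>n = exp (-cn/M) = (1 + M/d)\<^sup>-\<^sup>1 \<le> d/M\<close> by the choice of \<open>d\<close>.

  All contours consist of circular arcs and radial segments, i.e. of sides of rectangles in the
  logarithmic coordinate \<open>s + i\<theta>\<close>, where Cauchy's theorem follows by differentiating
  under the integral.\<close>

subsection \<open>Algebra of operators\<close>

lemma blinfun_compose_assoc: "(A o\<^sub>L B) o\<^sub>L C = A o\<^sub>L (B o\<^sub>L C)"
  by (rule blinfun_eqI) simp

lemma blinfun_compose_id [simp]: "id_blinfun o\<^sub>L A = A" "A o\<^sub>L id_blinfun = A"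
  by (rule blinfun_eqI; simp)+

lemmas blinfun_compose_simps =
  bounded_bilinear.add_left [OF bounded_bilinear_blinfun_compose]
  bounded_bilinear.add_right [OF bounded_bilinear_blinfun_compose]
  bounded_bilinear.diff_left [OF bounded_bilinear_blinfun_compose]
  bounded_bilinear.diff_right [OF bounded_bilinear_blinfun_compose]
  bounded_bilinear.minus_left [OF bounded_bilinear_blinfun_compose]
  bounded_bilinear.minus_right [OF bounded_bilinear_blinfun_compose]
  bounded_bilinear.scaleR_left [OF bounded_bilinear_blinfun_compose]
  bounded_bilinear.scaleR_right [OF bounded_bilinear_blinfun_compose]
  blinfun_compose_assoc

lemma norm_id_blinfun_diff_le:
  fixes T :: "'a::real_normed_vector \<Rightarrow>\<^sub>L 'a"
  shows "norm (id_blinfun - T) \<le> 1 + norm T"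
  using norm_triangle_ineq4 [of "id_blinfun :: 'a \<Rightarrow>\<^sub>L 'a" T] norm_blinfun_id_le [where 'a = 'a] by linarith

lemma op_pow_0 [simp]: "op_pow T 0 = id_blinfun"
  by (simp add: op_pow_def)

lemma op_pow_Suc: "op_pow T (Suc n) = T o\<^sub>L op_pow T n"
  by (simp add: op_pow_def)

lemma op_pow_commute:
  assumes "A o\<^sub>L T = T o\<^sub>L A"
  shows "A o\<^sub>L op_pow T n = op_pow T n o\<^sub>L A"
proof (induction n)
  case (Suc n)
  have "A o\<^sub>L op_pow T (Suc n) = (A o\<^sub>L T) o\<^sub>L op_pow T n"
    by (simp add: op_pow_Suc blinfun_compose_assoc)
  also have "\<dots> = T o\<^sub>L (A o\<^sub>L op_pow T n)"
    by (simp add: assms blinfun_compose_assoc)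
  finally show ?case by (simp add: Suc op_pow_Suc blinfun_compose_assoc)
qed simp

lemma op_pow_Suc2: "op_pow T (Suc n) = op_pow T n o\<^sub>L T"
  by (simp add: op_pow_Suc op_pow_commute)

lemma clinear_op_op_pow: "clinear_op J T \<Longrightarrow> clinear_op J (op_pow T n)"
  unfolding clinear_op_def by (metis op_pow_commute)

lemma clinear_op_compose: "clinear_op J A \<Longrightarrow> clinear_op J B \<Longrightarrow> clinear_op J (A o\<^sub>L B)"
  unfolding clinear_op_def by (metis blinfun_compose_assoc)

lemma clinear_op_diff: "clinear_op J A \<Longrightarrow> clinear_op J B \<Longrightarrow> clinear_op J (A - B)"
  by (simp add: clinear_op_def blinfun_compose_simps)

lemma clinear_op_add: "clinear_op J A \<Longrightarrow> clinear_op J B \<Longrightarrow> clinear_op J (A + B)"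
  by (simp add: clinear_op_def blinfun_compose_simps)

lemma clinear_op_id [simp]: "clinear_op J id_blinfun"
  by (simp add: clinear_op_def)

section \<open>Multiplication by complex scalars\<close>

lemma clinear_op_cscaleL [simp]: "clinear_op J (cscaleL J z)"
  by (simp add: clinear_op_def cscaleL_def blinfun_compose_simps)

lemma cscaleL_commute: "clinear_op J A \<Longrightarrow> A o\<^sub>L cscaleL J z = cscaleL J z o\<^sub>L A"
  by (simp add: clinear_op_def cscaleL_def blinfun_compose_simps)

lemma cscaleL_add: "cscaleL J (z + w) = cscaleL J z + cscaleL J w"
  by (simp add: cscaleL_def algebra_simps)

lemma cscaleL_diff: "cscaleL J (z - w) = cscaleL J z - cscaleL J w"
  by (simp add: cscaleL_def algebra_simps)

lemma cscaleL_scaleR: "cscaleL J (r *\<^sub>R z) = r *\<^sub>R cscaleL J z"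
  by (simp add: cscaleL_def algebra_simps)

lemma cscaleL_0 [simp]: "cscaleL J 0 = 0"
  by (simp add: cscaleL_def)

lemma cscaleL_1 [simp]: "cscaleL J 1 = id_blinfun"
  by (simp add: cscaleL_def)

lemma cscaleL_ii [simp]: "cscaleL J \<i> = J"
  by (simp add: cscaleL_def)

lemma blinfun_compose_complex_structure:
  "complex_structure J \<Longrightarrow> J o\<^sub>L J = - id_blinfun"
  by (rule blinfun_eqI) (simp add: complex_structure_def blinfun.bilinear_simps)

lemma cscaleL_mult:
  assumes "complex_structure J"
  shows "cscaleL J (z * w) = cscaleL J z o\<^sub>L cscaleL J w"
  by (simp add: cscaleL_def blinfun_compose_simps blinfun_compose_complex_structure [OF assms] algebra_simps)

lemma norm_cscaleL_le:
  assumes "complex_structure J"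
  shows "norm (cscaleL J z) \<le> cmod z"
proof (rule norm_blinfun_bound)
  fix x
  have "blinfun_apply (cscaleL J z) x = cscale J z x"
    by (simp add: cscaleL_def cscale_def blinfun.bilinear_simps)
  then show "norm (blinfun_apply (cscaleL J z) x) \<le> cmod z * norm x"
    using assms by (simp add: complex_structure_def)
qed simp

lemma norm_cscaleL_compose_le:
  assumes "complex_structure J"
  shows "norm (cscaleL J z o\<^sub>L A) \<le> cmod z * norm A"
  by (meson assms norm_blinfun_compose norm_cscaleL_le mult_right_mono norm_ge_zero order_trans)

text \<open>Makes multiplication of an operator by a complex scalar a bounded real bilinear map, so
  that \<open>\<lambda>h. cscaleL J h o\<^sub>L A\<close> can serve as a Frechet derivative.\<close>

lemma bounded_bilinear_cscaleL_compose:
  assumes "complex_structure J"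
  shows "bounded_bilinear (\<lambda>z A. cscaleL J z o\<^sub>L A)"
proof
  show "\<exists>K. \<forall>z A. norm (cscaleL J z o\<^sub>L A) \<le> norm z * norm A * K"
    using norm_cscaleL_compose_le [OF assms] by (intro exI [of _ 1]) auto
qed (simp_all add: cscaleL_add cscaleL_scaleR blinfun_compose_simps)

lemma cscaleL_power:
  assumes "complex_structure J" "clinear_op J T"
  shows "op_pow (cscaleL J z o\<^sub>L T) n = cscaleL J (z ^ n) o\<^sub>L op_pow T n"
proof (induction n)
  case (Suc n)
  have "op_pow (cscaleL J z o\<^sub>L T) (Suc n) = cscaleL J z o\<^sub>L (T o\<^sub>L cscaleL J (z ^ n)) o\<^sub>L op_pow T n"
    by (simp add: op_pow_Suc Suc blinfun_compose_assoc)
  also have "\<dots> = cscaleL J (z ^ Suc n) o\<^sub>L op_pow T (Suc n)"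
    by (simp add: cscaleL_commute [OF assms(2)] op_pow_Suc cscaleL_mult [OF assms(1)] blinfun_compose_assoc)
  finally show ?case .
qed simp

subsection \<open>The resolvent\<close>

text \<open>The hypothesis is on the powers of \<open>A\<close>, not on \<open>norm A\<close>, so
  that it covers both a small perturbation and T/z with T power-bounded, where \<open>norm A\<close>
  may exceed 1.\<close>

lemma neumann_series:
  fixes A :: "'a::banach \<Rightarrow>\<^sub>L 'a"
  assumes bd: "\<And>k. norm (op_pow A k) \<le> C * r ^ k" and r: "0 \<le> r" "r < 1"
  obtains S where "(id_blinfun - A) o\<^sub>L S = id_blinfun" "S o\<^sub>L (id_blinfun - A) = id_blinfun"
    "norm S \<le> C / (1 - r)"
proof
  define S where "S = (\<Sum>k. op_pow A k)"
  have sC: "summable (\<lambda>k. C * r ^ k)"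
    using r by (intro summable_mult summable_geometric) auto
  have sn: "summable (\<lambda>k. norm (op_pow A k))"
    by (rule summable_comparison_test' [OF sC, of 0]) (use bd in auto)
  have s: "summable (op_pow A)"
    using sn by (rule summable_norm_cancel)
  have Suc: "(\<Sum>k. op_pow A (Suc k)) = S - id_blinfun"
    using suminf_split_head [OF s] by (simp add: S_def)
  have "A o\<^sub>L S = (\<Sum>k. op_pow A (Suc k))" 
    unfolding S_def op_pow_Suc
    by (rule bounded_linear.suminf [OF bounded_bilinear.bounded_linear_right [OF bounded_bilinear_blinfun_compose] s])
  then show "(id_blinfun - A) o\<^sub>L S = id_blinfun"
    by (simp add: blinfun_compose_simps Suc)
  have "S o\<^sub>L A = (\<Sum>k. op_pow A (Suc k))"
    unfolding S_def op_pow_Suc2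
    by (rule bounded_linear.suminf [OF bounded_bilinear.bounded_linear_left [OF bounded_bilinear_blinfun_compose] s])
  then show "S o\<^sub>L (id_blinfun - A) = id_blinfun"
    by (simp add: blinfun_compose_simps Suc)
  have "norm S \<le> (\<Sum>k. norm (op_pow A k))"
    unfolding S_def by (rule summable_norm [OF sn])
  also have "\<dots> \<le> (\<Sum>k. C * r ^ k)"
    by (rule suminf_le [OF bd sn sC])
  also have "\<dots> = C / (1 - r)"
    using r by (simp add: suminf_mult suminf_geometric summable_geometric)
  finally show "norm S \<le> C / (1 - r)" .
qed

lemma inverse_commute:
  assumes "S o\<^sub>L A = id_blinfun" "A o\<^sub>L S = id_blinfun" "A o\<^sub>L B = B o\<^sub>L A"
  shows "S o\<^sub>L B = B o\<^sub>L S"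
proof -
  have "S o\<^sub>L B = S o\<^sub>L (B o\<^sub>L A) o\<^sub>L S"
    by (simp add: assms(2) blinfun_compose_assoc)
  also have "\<dots> = (S o\<^sub>L A) o\<^sub>L B o\<^sub>L S"
    by (simp only: assms(3) [symmetric] blinfun_compose_assoc)
  finally show ?thesis by (simp add: assms(1))
qed

lemma resolvent_eqI:
  assumes "S o\<^sub>L (cscaleL J z - T) = id_blinfun" "(cscaleL J z - T) o\<^sub>L S = id_blinfun"
  shows "resolvent J z T = S"
  unfolding resolvent_def
proof (rule the_equality)
  fix S' assume S': "S' o\<^sub>L (cscaleL J z - T) = id_blinfun \<and> (cscaleL J z - T) o\<^sub>L S' = id_blinfun"
  have "S' = S' o\<^sub>L ((cscaleL J z - T) o\<^sub>L S)"
    by (simp add: assms)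
  also have "\<dots> = (S' o\<^sub>L (cscaleL J z - T)) o\<^sub>L S"
    by (simp only: blinfun_compose_assoc)
  finally show "S' = S" using S' by simp
qed (use assms in auto)

lemma resolvent_inverse:
  assumes "z \<notin> op_spectrum J T"
  shows "resolvent J z T o\<^sub>L (cscaleL J z - T) = id_blinfun"
    and "(cscaleL J z - T) o\<^sub>L resolvent J z T = id_blinfun"
proof -
  obtain S where S: "S o\<^sub>L (cscaleL J z - T) = id_blinfun" "(cscaleL J z - T) o\<^sub>L S = id_blinfun"
    using assms by (auto simp: op_spectrum_def op_invertible_def)
  then show "resolvent J z T o\<^sub>L (cscaleL J z - T) = id_blinfun"
      "(cscaleL J z - T) o\<^sub>L resolvent J z T = id_blinfun"
    by (simp_all add: resolvent_eqI [OF S])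
qed

text \<open>An inverse of a complex linear operator commutes with \<open>J\<close> automatically, so
  every two-sided inverse meets the requirement in \<open>op_invertible\<close>.\<close>

lemma not_in_op_spectrumI:
  assumes T: "clinear_op J T"
    and S: "S o\<^sub>L (cscaleL J z - T) = id_blinfun" "(cscaleL J z - T) o\<^sub>L S = id_blinfun"
  shows "z \<notin> op_spectrum J T"
proof -
  have "clinear_op J (cscaleL J z - T)"
    using T by (simp add: clinear_op_diff)
  then have "S o\<^sub>L J = J o\<^sub>L S"
    by (intro inverse_commute [OF S]) (simp add: clinear_op_def)
  then show ?thesis
    using S by (auto simp: op_spectrum_def op_invertible_def clinear_op_def)
qed

lemma clinear_op_resolvent:
  assumes "clinear_op J T" "z \<notin> op_spectrum J T"
  shows "clinear_op J (resolvent J z T)"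
proof -
  have "clinear_op J (cscaleL J z - T)"
    using assms by (simp add: clinear_op_diff)
  then show ?thesis
    unfolding clinear_op_def by (rule inverse_commute [OF resolvent_inverse [OF assms(2)]])
qed

lemma resolvent_commute:
  assumes "clinear_op J T" "z \<notin> op_spectrum J T"
  shows "resolvent J z T o\<^sub>L T = T o\<^sub>L resolvent J z T"
  by (rule inverse_commute [OF resolvent_inverse [OF assms(2)]])
    (simp add: blinfun_compose_simps cscaleL_commute [OF assms(1)])

text \<open>Factor w - T = (I - A)(z - T) with A = (z - w)R(z); the hypothesis says that A has norm
  at most r < 1, so the Neumann series inverts I - A.\<close>

lemma resolvent_perturbation:
  fixes T :: "'a::banach \<Rightarrow>\<^sub>L 'a"
  assumes J: "complex_structure J" and T: "clinear_op J T" and z: "z \<notin> op_spectrum J T"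
    and r: "cmod (w - z) * norm (resolvent J z T) \<le> r" "r < 1"
  shows "w \<notin> op_spectrum J T" "norm (resolvent J w T) \<le> norm (resolvent J z T) / (1 - r)"
proof -
  define R where "R = resolvent J z T"
  define B where "B = cscaleL J z - T"
  define A where "A = cscaleL J (z - w) o\<^sub>L R"
  have R: "R o\<^sub>L B = id_blinfun" "B o\<^sub>L R = id_blinfun" "clinear_op J R"
    using resolvent_inverse [OF z] clinear_op_resolvent [OF T z] by (simp_all add: R_def B_def)
  have "norm A \<le> cmod (z - w) * norm R"
    unfolding A_def by (rule norm_cscaleL_compose_le [OF J])
  then have nA: "norm A \<le> r"
    using r by (simp add: R_def norm_minus_commute)
  have r0: "0 \<le> r"
    using nA norm_ge_zero order_trans by blast
  have "norm (op_pow A k) \<le> 1 * r ^ k" for k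
  proof (induction k)
    case 0
    then show ?case by (simp add: norm_blinfun_id_le)
  next
    case (Suc k)
    have "norm (op_pow A (Suc k)) \<le> norm A * norm (op_pow A k)"
      unfolding op_pow_Suc by (rule norm_blinfun_compose)
    also have "\<dots> \<le> r * (1 * r ^ k)"
      by (intro mult_mono nA Suc) (auto simp: r0)
    finally show ?case by simp
  qed
  from neumann_series [OF this r0 r(2)] obtain S where
    S: "(id_blinfun - A) o\<^sub>L S = id_blinfun" "S o\<^sub>L (id_blinfun - A) = id_blinfun"
    and nS: "norm S \<le> 1 / (1 - r)" by blast
  have RA: "R o\<^sub>L cscaleL J (z - w) = A"
    by (simp add: A_def cscaleL_commute [OF R(3)])
  have CB: "cscaleL J w - T = B - cscaleL J (z - w)"
    by (simp add: B_def cscaleL_diff)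
  have AB: "A o\<^sub>L B = cscaleL J (z - w)"
    unfolding A_def by (simp add: blinfun_compose_assoc R)
  have BA: "B o\<^sub>L A = cscaleL J (z - w)"
    unfolding RA [symmetric] by (simp add: R flip: blinfun_compose_assoc)
  have W1: "cscaleL J w - T = (id_blinfun - A) o\<^sub>L B"
    by (simp add: CB blinfun_compose_simps AB)
  have W2: "cscaleL J w - T = B o\<^sub>L (id_blinfun - A)"
    by (simp add: CB blinfun_compose_simps BA)
  \<comment> \<open>The factorisations \<open>W1\<close> and \<open>W2\<close> yield a right inverse
    \<open>R o\<^sub>L S\<close> and a left inverse \<open>S o\<^sub>L R\<close>; commutation
    identifies them.\<close>
  have SR: "S o\<^sub>L R = R o\<^sub>L S"
    by (rule inverse_commute [OF S(2,1)])
      (simp add: blinfun_compose_simps A_def blinfun_compose_assoc [symmetric] cscaleL_commute [OF R(3)]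
        del: blinfun_compose_assoc)
  have "(S o\<^sub>L R) o\<^sub>L (cscaleL J w - T) = S o\<^sub>L ((R o\<^sub>L B) o\<^sub>L (id_blinfun - A))"
    by (simp only: W2 blinfun_compose_assoc)
  then have 1: "(S o\<^sub>L R) o\<^sub>L (cscaleL J w - T) = id_blinfun"
    by (simp add: R S)
  have "(cscaleL J w - T) o\<^sub>L (S o\<^sub>L R) = (id_blinfun - A) o\<^sub>L ((B o\<^sub>L R) o\<^sub>L S)"
    by (simp only: W1 blinfun_compose_assoc SR)
  then have 2: "(cscaleL J w - T) o\<^sub>L (S o\<^sub>L R) = id_blinfun"
    by (simp add: R S)
  show "w \<notin> op_spectrum J T"
    by (rule not_in_op_spectrumI [OF T 1 2])
  have "norm (resolvent J w T) \<le> norm S * norm R"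
    unfolding resolvent_eqI [OF 1 2] by (rule norm_blinfun_compose)
  also have "\<dots> \<le> 1 / (1 - r) * norm R"
    by (intro mult_right_mono nS) auto
  finally show "norm (resolvent J w T) \<le> norm (resolvent J z T) / (1 - r)"
    by (simp add: R_def)
qed

text \<open>Factor z - T = z(I - T/z): the powers of T/z are bounded by K/|z|^k, and (1/|z|) K/(1 -
  1/|z|) = K/(|z| - 1).\<close>

lemma resolvent_outside_disc:
  fixes T :: "'a::banach \<Rightarrow>\<^sub>L 'a"
  assumes J: "complex_structure J" and T: "clinear_op J T"
    and K: "\<And>n. norm (op_pow T n) \<le> K" and z: "cmod z > 1"
  shows "z \<notin> op_spectrum J T" "norm (resolvent J z T) \<le> K / (cmod z - 1)"
proof -
  define A where "A = cscaleL J (inverse z) o\<^sub>L T"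
  have [simp]: "z \<noteq> 0" using z by auto
  have "norm (op_pow A k) \<le> K * inverse (cmod z) ^ k" for k
  proof -
    have "norm (op_pow A k) \<le> cmod (inverse z ^ k) * norm (op_pow T k)"
      unfolding A_def cscaleL_power [OF J T] by (rule norm_cscaleL_compose_le [OF J])
    also have "\<dots> \<le> cmod (inverse z ^ k) * K"
      by (intro mult_left_mono K) auto
    finally show ?thesis by (simp add: norm_power norm_inverse mult.commute)
  qed
  from neumann_series [OF this] z obtain S where
    S: "(id_blinfun - A) o\<^sub>L S = id_blinfun" "S o\<^sub>L (id_blinfun - A) = id_blinfun"
    and nS: "norm S \<le> K / (1 - inverse (cmod z))"
    by (metis inverse_less_1_iff norm_ge_zero inverse_nonnegative_iff_nonnegative)
  have zi: "cscaleL J z o\<^sub>L cscaleL J (inverse z) = id_blinfun"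
     "cscaleL J (inverse z) o\<^sub>L cscaleL J z = id_blinfun"
    by (simp_all flip: cscaleL_mult [OF J])
  have "cscaleL J z o\<^sub>L A = T"
    unfolding A_def by (simp add: zi flip: blinfun_compose_assoc)
  then have W1: "cscaleL J z - T = cscaleL J z o\<^sub>L (id_blinfun - A)"
    by (simp add: blinfun_compose_simps)
  have W2: "cscaleL J z - T = (id_blinfun - A) o\<^sub>L cscaleL J z"
    unfolding W1 by (rule sym [OF cscaleL_commute])
      (simp add: A_def clinear_op_diff clinear_op_compose T)
  have SC: "S o\<^sub>L cscaleL J (inverse z) = cscaleL J (inverse z) o\<^sub>L S"
    by (rule inverse_commute [OF S(2,1)], rule cscaleL_commute)
      (simp add: A_def clinear_op_diff clinear_op_compose T)
  have "(cscaleL J (inverse z) o\<^sub>L S) o\<^sub>L (cscaleL J z - T)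
      = cscaleL J (inverse z) o\<^sub>L ((S o\<^sub>L (id_blinfun - A)) o\<^sub>L cscaleL J z)"
    by (simp only: W2 blinfun_compose_assoc)
  then have 1: "(cscaleL J (inverse z) o\<^sub>L S) o\<^sub>L (cscaleL J z - T) = id_blinfun"
    by (simp add: S zi)
  have "(cscaleL J z - T) o\<^sub>L (cscaleL J (inverse z) o\<^sub>L S)
      = cscaleL J z o\<^sub>L (((id_blinfun - A) o\<^sub>L S) o\<^sub>L cscaleL J (inverse z))"
    by (simp only: W1 blinfun_compose_assoc SC)
  then have 2: "(cscaleL J z - T) o\<^sub>L (cscaleL J (inverse z) o\<^sub>L S) = id_blinfun"
    by (simp add: S zi)
  show "z \<notin> op_spectrum J T"
    by (rule not_in_op_spectrumI [OF T 1 2])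
  have "norm (resolvent J z T) \<le> cmod (inverse z) * norm S"
    unfolding resolvent_eqI [OF 1 2] by (rule norm_cscaleL_compose_le [OF J])
  also have "\<dots> \<le> cmod (inverse z) * (K / (1 - inverse (cmod z)))"
    by (intro mult_left_mono nS) auto
  also have "\<dots> = K / (cmod z - 1)"
    using z by (simp only: norm_inverse) (simp add: divide_simps)
  finally show "norm (resolvent J z T) \<le> K / (cmod z - 1)" .
qed

text \<open>Shows what the factor I - T gains near 1: the resolvent occurs only with the small
  factor z - 1.\<close>

lemma id_minus_compose_resolvent:
  assumes "clinear_op J T" "z \<notin> op_spectrum J T"
  shows "(id_blinfun - T) o\<^sub>L resolvent J z T = id_blinfun - (cscaleL J (z - 1) o\<^sub>L resolvent J z T)"
proof -
  have "cscaleL J z o\<^sub>L resolvent J z T = id_blinfun + (T o\<^sub>L resolvent J z T)"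
    using resolvent_inverse(2) [OF assms(2)] by (simp add: blinfun_compose_simps algebra_simps)
  then show ?thesis
    by (simp add: blinfun_compose_simps cscaleL_diff)
qed

subsection \<open>Operator-valued holomorphic functions\<close>

text \<open>The increment h acts through \<open>cscaleL\<close>, which makes the derivative complex.
  Continuity of the derivative is built in, so differentiation under the integral is available at
  once; complex linearity of the values lets scalars pass through them in the product rule.\<close>

definition op_holomorphic_on ::
  "('a::real_normed_vector \<Rightarrow>\<^sub>L 'a) \<Rightarrow> (complex \<Rightarrow> ('a \<Rightarrow>\<^sub>L 'a)) \<Rightarrow> complex set \<Rightarrow> bool" where
  "op_holomorphic_on J F V \<longleftrightarrow> (\<forall>z\<in>V. clinear_op J (F z)) \<and>
     (\<exists>F'. continuous_on V F' \<and> (\<forall>z\<in>V. (F has_derivative (\<lambda>h. cscaleL J h o\<^sub>L F' z)) (at z)))"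

lemma op_holomorphic_onI:
  assumes "\<And>z. z \<in> V \<Longrightarrow> clinear_op J (F z)" "continuous_on V F'"
    "\<And>z. z \<in> V \<Longrightarrow> (F has_derivative (\<lambda>h. cscaleL J h o\<^sub>L F' z)) (at z)"
  shows "op_holomorphic_on J F V"
  using assms unfolding op_holomorphic_on_def by blast

lemma op_holomorphic_onE:
  assumes "op_holomorphic_on J F V"
  obtains F' where "\<And>z. z \<in> V \<Longrightarrow> clinear_op J (F z)" "continuous_on V F'"
    "\<And>z. z \<in> V \<Longrightarrow> (F has_derivative (\<lambda>h. cscaleL J h o\<^sub>L F' z)) (at z)"
    "continuous_on V F"
proof -
  obtain F' where *: "\<And>z. z \<in> V \<Longrightarrow> clinear_op J (F z)" "continuous_on V F'"
    "\<And>z. z \<in> V \<Longrightarrow> (F has_derivative (\<lambda>h. cscaleL J h o\<^sub>L F' z)) (at z)"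
    using assms unfolding op_holomorphic_on_def by blast
  moreover have "continuous_on V F"
    by (rule continuous_at_imp_continuous_on) (use *(3) has_derivative_continuous in blast)
  ultimately show ?thesis using that by blast
qed

lemma op_holomorphic_on_subset:
  "op_holomorphic_on J F V \<Longrightarrow> U \<subseteq> V \<Longrightarrow> op_holomorphic_on J F U"
  unfolding op_holomorphic_on_def by (meson continuous_on_subset subsetD)

lemma op_holomorphic_on_const:
  "clinear_op J A \<Longrightarrow> op_holomorphic_on J (\<lambda>z. A) V"
  by (rule op_holomorphic_onI [where F' = "\<lambda>z. 0"]) (auto intro!: derivative_eq_intros)

lemma op_holomorphic_on_add:
  assumes "op_holomorphic_on J F V" "op_holomorphic_on J G V"
  shows "op_holomorphic_on J (\<lambda>z. F z + G z) V"
proof -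
  obtain F' where F: "\<And>z. z \<in> V \<Longrightarrow> clinear_op J (F z)" "continuous_on V F'"
    "\<And>z. z \<in> V \<Longrightarrow> (F has_derivative (\<lambda>h. cscaleL J h o\<^sub>L F' z)) (at z)" "continuous_on V F"
    by (rule op_holomorphic_onE [OF assms(1)]) (rule that)
  obtain G' where G: "\<And>z. z \<in> V \<Longrightarrow> clinear_op J (G z)" "continuous_on V G'"
    "\<And>z. z \<in> V \<Longrightarrow> (G has_derivative (\<lambda>h. cscaleL J h o\<^sub>L G' z)) (at z)" "continuous_on V G"
    by (rule op_holomorphic_onE [OF assms(2)]) (rule that)
  show ?thesis
    by (rule op_holomorphic_onI [where F' = "\<lambda>z. F' z + G' z"])
      (use F G in \<open>auto simp: clinear_op_add blinfun_compose_simps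
         intro!: continuous_intros derivative_eq_intros\<close>)
qed

lemma op_holomorphic_on_compose:
  assumes "op_holomorphic_on J F V" "op_holomorphic_on J G V"
  shows "op_holomorphic_on J (\<lambda>z. F z o\<^sub>L G z) V"
proof -
  obtain F' where F: "\<And>z. z \<in> V \<Longrightarrow> clinear_op J (F z)" "continuous_on V F'"
    "\<And>z. z \<in> V \<Longrightarrow> (F has_derivative (\<lambda>h. cscaleL J h o\<^sub>L F' z)) (at z)" "continuous_on V F"
    by (rule op_holomorphic_onE [OF assms(1)]) (rule that)
  obtain G' where G: "\<And>z. z \<in> V \<Longrightarrow> clinear_op J (G z)" "continuous_on V G'"
    "\<And>z. z \<in> V \<Longrightarrow> (G has_derivative (\<lambda>h. cscaleL J h o\<^sub>L G' z)) (at z)" "continuous_on V G"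
    by (rule op_holomorphic_onE [OF assms(2)]) (rule that)
  show ?thesis
  proof (rule op_holomorphic_onI [where F' = "\<lambda>z. (F z o\<^sub>L G' z) + (F' z o\<^sub>L G z)"])
    fix z assume z: "z \<in> V"
    show "clinear_op J (F z o\<^sub>L G z)"
      using F(1) G(1) z by (simp add: clinear_op_compose)
    \<comment> \<open>Complex linearity of \<open>F z\<close> moves the scalar to the front, as the
      form of the derivative demands.\<close>
    have "(\<lambda>h. F z o\<^sub>L (cscaleL J h o\<^sub>L G' z)) = (\<lambda>h. cscaleL J h o\<^sub>L (F z o\<^sub>L G' z))"
      using cscaleL_commute [OF F(1) [OF z]] by (simp flip: blinfun_compose_assoc)
    then have eq: "(\<lambda>h. (F z o\<^sub>L (cscaleL J h o\<^sub>L G' z)) + ((cscaleL J h o\<^sub>L F' z) o\<^sub>L G z)) =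
        (\<lambda>h. cscaleL J h o\<^sub>L ((F z o\<^sub>L G' z) + (F' z o\<^sub>L G z)))"
      by (simp add: blinfun_compose_simps fun_eq_iff)
    show "((\<lambda>z. F z o\<^sub>L G z) has_derivative (\<lambda>h. cscaleL J h o\<^sub>L ((F z o\<^sub>L G' z) + (F' z o\<^sub>L G z)))) (at z)"
      using bounded_bilinear.FDERIV [OF bounded_bilinear_blinfun_compose F(3) [OF z] G(3) [OF z]]
      unfolding eq .
  qed (use F G in \<open>auto intro!: continuous_intros\<close>)
qed

lemma continuous_on_cscaleL [continuous_intros]:
  "continuous_on V f \<Longrightarrow> continuous_on V (\<lambda>z. cscaleL J (f z))"
  unfolding cscaleL_def by (intro continuous_intros)

lemma op_holomorphic_on_cscaleL:
  assumes J: "complex_structure J" and "open V" "f holomorphic_on V"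
  shows "op_holomorphic_on J (\<lambda>z. cscaleL J (f z)) V"
proof (rule op_holomorphic_onI [where F' = "\<lambda>z. cscaleL J (deriv f z)"])
  show "continuous_on V (\<lambda>z. cscaleL J (deriv f z))"
    using assms by (intro continuous_intros holomorphic_on_imp_continuous_on holomorphic_deriv)
  fix z assume "z \<in> V"
  then have "(f has_derivative (*) (deriv f z)) (at z)"
    using assms holomorphic_derivI has_field_derivative_def by blast
  then have "((\<lambda>z. cscaleL J (f z)) has_derivative (\<lambda>h. cscaleL J (deriv f z * h))) (at z)"
    unfolding cscaleL_def
    by (auto intro!: derivative_eq_intros bounded_linear.has_derivative [OF bounded_linear_Re]
        bounded_linear.has_derivative [OF bounded_linear_Im])
  then show "((\<lambda>z. cscaleL J (f z)) has_derivative (\<lambda>h. cscaleL J h o\<^sub>L cscaleL J (deriv f z))) (at z)"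
    by (simp add: cscaleL_mult [OF J] mult.commute [of "deriv f z"])
qed simp

lemma op_holomorphic_on_compose_exp:
  assumes J: "complex_structure J" and F: "op_holomorphic_on J F V"
  shows "op_holomorphic_on J (\<lambda>z. F (exp z)) (exp -` V)"
proof -
  obtain F' where F: "\<And>z. z \<in> V \<Longrightarrow> clinear_op J (F z)" "continuous_on V F'"
    "\<And>z. z \<in> V \<Longrightarrow> (F has_derivative (\<lambda>h. cscaleL J h o\<^sub>L F' z)) (at z)" "continuous_on V F"
    by (rule op_holomorphic_onE [OF F]) (rule that)
  show ?thesis
  proof (rule op_holomorphic_onI [where F' = "\<lambda>z. cscaleL J (exp z) o\<^sub>L F' (exp z)"])
    show "continuous_on (exp -` V) (\<lambda>z. cscaleL J (exp z) o\<^sub>L F' (exp z))"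
      by (intro continuous_intros continuous_on_compose2 [OF F(2)]) auto
    fix z assume z: "z \<in> exp -` V"
    then show "clinear_op J (F (exp z))" using F by simp
    have "(exp has_derivative (\<lambda>h. exp z * h)) (at z)"
      using DERIV_exp [of z] by (simp add: has_field_derivative_def)
    from has_derivative_compose [OF this F(3)] z
    have "((\<lambda>z. F (exp z)) has_derivative (\<lambda>h. cscaleL J (exp z * h) o\<^sub>L F' (exp z))) (at z)"
      by simp
    then show "((\<lambda>z. F (exp z)) has_derivative
        (\<lambda>h. cscaleL J h o\<^sub>L (cscaleL J (exp z) o\<^sub>L F' (exp z)))) (at z)"
      by (simp add: cscaleL_mult [OF J] mult.commute [of "exp z"] blinfun_compose_assoc)
  qed
qed

section \<open>The resolvent as a holomorphic function\<close>

lemma open_resolvent_set: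
  fixes T :: "'a::banach \<Rightarrow>\<^sub>L 'a"
  assumes J: "complex_structure J" and T: "clinear_op J T"
  shows "open (- op_spectrum J T)"
proof (rule openI)
  fix z assume z: "z \<in> - op_spectrum J T"
  \<comment> \<open>Adding 1 keeps \<open>N\<close> positive in the zero space too; within distance
    1/(2N) of z the perturbation lemma applies with r = 1/2.\<close>
  define N where "N = norm (resolvent J z T) + 1"
  have N: "N > 0" by (simp add: N_def add_nonneg_pos)
  have "w \<in> - op_spectrum J T" if "w \<in> ball z (1 / (2 * N))" for w
  proof -
    have "cmod (w - z) * norm (resolvent J z T) \<le> 1 / (2 * N) * N"
      using that N by (intro mult_mono) (auto simp: dist_norm norm_minus_commute N_def)
    also have "\<dots> = 1 / 2" using N by simp
    finally show ?thesis
      using resolvent_perturbation(1) [OF J T, of z w "1/2"] z by auto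
  qed
  then show "\<exists>e>0. ball z e \<subseteq> - op_spectrum J T"
    using N by (intro exI [of _ "1 / (2 * N)"]) auto
qed

text \<open>Insert (z - T)R(z) = I and R(w)(w - T) = I into the difference; T cancels in the
  middle.\<close>

lemma resolvent_identity:
  assumes J: "complex_structure J" and T: "clinear_op J T"
    and z: "z \<notin> op_spectrum J T" "w \<notin> op_spectrum J T"
  shows "resolvent J w T - resolvent J z T = - (cscaleL J (w - z) o\<^sub>L (resolvent J w T o\<^sub>L resolvent J z T))"
proof -
  let ?Rw = "resolvent J w T" and ?Rz = "resolvent J z T"
  have "?Rw - ?Rz = (?Rw o\<^sub>L ((cscaleL J z - T) o\<^sub>L ?Rz)) - ((?Rw o\<^sub>L (cscaleL J w - T)) o\<^sub>L ?Rz)"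
    by (simp add: resolvent_inverse(2) [OF z(1)] resolvent_inverse(1) [OF z(2)])
  also have "\<dots> = - (?Rw o\<^sub>L (cscaleL J (w - z) o\<^sub>L ?Rz))"
    by (simp add: cscaleL_diff blinfun_compose_simps)
  also have "\<dots> = - ((?Rw o\<^sub>L cscaleL J (w - z)) o\<^sub>L ?Rz)"
    by (simp only: blinfun_compose_assoc)
  finally show ?thesis
    by (simp only: cscaleL_commute [OF clinear_op_resolvent [OF T z(2)]] blinfun_compose_assoc)
qed

lemma continuous_on_resolvent:
  fixes T :: "'a::banach \<Rightarrow>\<^sub>L 'a"
  assumes J: "complex_structure J" and T: "clinear_op J T"
  shows "continuous_on (- op_spectrum J T) (\<lambda>z. resolvent J z T)"
proof (rule continuous_at_imp_continuous_on, rule ballI)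
  fix z assume z: "z \<in> - op_spectrum J T"
  define N where "N = norm (resolvent J z T) + 1"
  have N: "N > 0" by (simp add: N_def add_nonneg_pos)
  \<comment> \<open>By the resolvent identity the difference is at most |w - z| times two resolvent
    norms, one at most 2N (perturbation with r = 1/2), the other at most N.\<close>
  have bd: "norm (resolvent J w T - resolvent J z T) \<le> cmod (w - z) * (2 * N * N)"
    if w: "w \<in> ball z (1 / (2 * N))" for w
  proof -
    have "cmod (w - z) * norm (resolvent J z T) \<le> 1 / (2 * N) * N"
      using w N by (intro mult_mono) (auto simp: dist_norm norm_minus_commute N_def)
    also have "\<dots> = 1 / 2" using N by simp
    finally have r: "cmod (w - z) * norm (resolvent J z T) \<le> 1 / 2" .
    have w': "w \<notin> op_spectrum J T" "norm (resolvent J w T) \<le> 2 * N"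
      using resolvent_perturbation [OF J T, of z w "1/2"] z r by (auto simp: N_def)
    have "norm (resolvent J w T - resolvent J z T) \<le> cmod (w - z) * norm (resolvent J w T o\<^sub>L resolvent J z T)"
      using resolvent_identity [OF J T, of z w] z w'
        norm_cscaleL_compose_le [OF J, of "w - z"] by simp
    also have "\<dots> \<le> cmod (w - z) * (norm (resolvent J w T) * norm (resolvent J z T))"
      by (intro mult_left_mono norm_blinfun_compose) auto
    also have "\<dots> \<le> cmod (w - z) * (2 * N * N)"
      using w' N by (intro mult_left_mono mult_mono) (auto simp: N_def)
    finally show ?thesis .
  qed
  have "((\<lambda>w. resolvent J w T - resolvent J z T) \<longlongrightarrow> 0) (at z)"
  proof (rule Lim_null_comparison)
    show "\<forall>\<^sub>F w in at z. norm (resolvent J w T - resolvent J z T) \<le> cmod (w - z) * (2 * N * N)"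
      using N by (auto simp: eventually_at_filter intro!: eventually_mono [OF eventually_nhds_ball [of "1 / (2 * N)" z]] bd)
    show "((\<lambda>w. cmod (w - z) * (2 * N * N)) \<longlongrightarrow> 0) (at z)"
      by (auto intro!: tendsto_eq_intros)
  qed
  then show "isCont (\<lambda>z. resolvent J z T) z"
    unfolding isCont_def by (rule LIM_zero_cancel)
qed

text \<open>The derivative is -R(z)^2. By the resolvent identity the remainder is -(w - z)(R(w) -
  R(z))R(z), so continuity of the resolvent suffices.\<close>

lemma op_holomorphic_on_resolvent:
  fixes T :: "'a::banach \<Rightarrow>\<^sub>L 'a"
  assumes J: "complex_structure J" and T: "clinear_op J T"
  shows "op_holomorphic_on J (\<lambda>z. resolvent J z T) (- op_spectrum J T)"
proof (rule op_holomorphic_onI [where F' = "\<lambda>z. - (resolvent J z T o\<^sub>L resolvent J z T)"])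
  let ?R = "\<lambda>z. resolvent J z T"
  show "continuous_on (- op_spectrum J T) (\<lambda>z. - (?R z o\<^sub>L ?R z))"
    by (intro continuous_intros continuous_on_resolvent J T)
  fix z assume z: "z \<in> - op_spectrum J T"
  show "clinear_op J (?R z)"
    using clinear_op_resolvent T z by blast
  have isC: "isCont ?R z"
    using continuous_on_eq_continuous_at [OF open_resolvent_set [OF J T]] continuous_on_resolvent [OF J T] z
    by blast
  show "(?R has_derivative (\<lambda>h. cscaleL J h o\<^sub>L - (?R z o\<^sub>L ?R z))) (at z)"
    unfolding has_derivative_within
  proof
    show "bounded_linear (\<lambda>h. cscaleL J h o\<^sub>L - (?R z o\<^sub>L ?R z))"
      by (rule bounded_bilinear.bounded_linear_left [OF bounded_bilinear_cscaleL_compose [OF J]])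
    have "norm ((1 / norm (w - z)) *\<^sub>R (?R w - (?R z + (cscaleL J (w - z) o\<^sub>L - (?R z o\<^sub>L ?R z)))))
        \<le> norm (?R w - ?R z) * norm (?R z)" if w: "w \<in> - op_spectrum J T" "w \<noteq> z" for w
    proof -
      have "?R w - (?R z + (cscaleL J (w - z) o\<^sub>L - (?R z o\<^sub>L ?R z)))
          = - (cscaleL J (w - z) o\<^sub>L ((?R w - ?R z) o\<^sub>L ?R z))"
        using resolvent_identity [OF J T, of z w] z w
        by (simp add: blinfun_compose_simps algebra_simps)
      then have "norm (?R w - (?R z + (cscaleL J (w - z) o\<^sub>L - (?R z o\<^sub>L ?R z))))
          \<le> cmod (w - z) * norm ((?R w - ?R z) o\<^sub>L ?R z)"
        using norm_cscaleL_compose_le [OF J] by simp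
      also have "\<dots> \<le> cmod (w - z) * (norm (?R w - ?R z) * norm (?R z))"
        by (intro mult_left_mono norm_blinfun_compose) auto
      finally show ?thesis
        using w by (simp add: divide_simps mult.commute)
    qed
    moreover have "\<forall>\<^sub>F w in at z. w \<in> - op_spectrum J T \<and> w \<noteq> z"
      using eventually_nhds_in_open [OF open_resolvent_set [OF J T] z]
      by (auto simp: eventually_at_filter elim: eventually_mono)
    ultimately have ev: "\<forall>\<^sub>F w in at z.
        norm ((1 / norm (w - z)) *\<^sub>R (?R w - (?R z + (cscaleL J (w - z) o\<^sub>L - (?R z o\<^sub>L ?R z)))))
        \<le> norm (?R w - ?R z) * norm (?R z)"
      by (auto elim: eventually_mono)
    show "((\<lambda>w. (1 / norm (w - z)) *\<^sub>R (?R w - (?R z + (cscaleL J (w - z) o\<^sub>L - (?R z o\<^sub>L ?R z))))) \<longlongrightarrow> 0) (at z)"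
      by (rule Lim_null_comparison [OF ev])
        (use isC in \<open>auto simp: isCont_def intro!: tendsto_eq_intros\<close>)
  qed
qed

subsection \<open>Cauchy's theorem in polar coordinates\<close>

text \<open>The s-derivative of the integral over the vertical side at s is, up to the factor -i,
  the difference of the values at its two ends. Bounding that difference instead of each end lets
  periodic functions give \<open>B = 0\<close>.\<close>

lemma cauchy_rectangle:
  fixes F :: "complex \<Rightarrow> 'a::banach \<Rightarrow>\<^sub>L 'a"
  assumes J: "complex_structure J" and F: "op_holomorphic_on J F V"
    and ab: "a \<le> b" "\<alpha> \<le> \<beta>"
    and V: "\<And>s \<theta>. s \<in> {a..b} \<Longrightarrow> \<theta> \<in> {\<alpha>..\<beta>} \<Longrightarrow> Complex s \<theta> \<in> V"
    and B: "\<And>s. s \<in> {a..b} \<Longrightarrow> norm (F (Complex s \<beta>) - F (Complex s \<alpha>)) \<le> B"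
  shows "norm (integral {\<alpha>..\<beta>} (\<lambda>\<theta>. F (Complex b \<theta>)) - integral {\<alpha>..\<beta>} (\<lambda>\<theta>. F (Complex a \<theta>))) \<le> B * (b - a)"
proof -
  obtain F' where "\<And>z. z \<in> V \<Longrightarrow> clinear_op J (F z)" and F': "continuous_on V F'"
    "\<And>z. z \<in> V \<Longrightarrow> (F has_derivative (\<lambda>h. cscaleL J h o\<^sub>L F' z)) (at z)"
    and Fc: "continuous_on V F"
    by (rule op_holomorphic_onE [OF F]) (rule that)
  define I where "I = (\<lambda>s. integral (cbox \<alpha> \<beta>) (\<lambda>\<theta>. F (Complex s \<theta>)))"
  define D where "D = (\<lambda>s. - (J o\<^sub>L (F (Complex s \<beta>) - F (Complex s \<alpha>))))"
  have cC [continuous_intros]: "continuous_on U (\<lambda>x. Complex (f x) (g x))"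
    if "continuous_on U f" "continuous_on U g" for U :: "'b::topological_space set" and f g
    using that by (rule continuous_on_Complex)
  have ds: "((\<lambda>s. F (Complex s \<theta>)) has_vector_derivative F' (Complex s \<theta>)) (at s within {a..b})"
    if "s \<in> {a..b}" "\<theta> \<in> cbox \<alpha> \<beta>" for s \<theta>
  proof -
    have "((\<lambda>s. Complex s \<theta>) has_derivative (\<lambda>h. complex_of_real h)) (at s within {a..b})"
      unfolding Complex_eq by (auto intro!: derivative_eq_intros)
    from has_derivative_compose [OF this F'(2)] V that
    show ?thesis
      by (auto simp: has_vector_derivative_def cscaleL_def blinfun_compose_simps)
  qed
  have dt: "((\<lambda>\<theta>. F (Complex s \<theta>)) has_vector_derivative (J o\<^sub>L F' (Complex s \<theta>))) (at \<theta> within {\<alpha>..\<beta>})"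
    if "s \<in> {a..b}" "\<theta> \<in> {\<alpha>..\<beta>}" for s \<theta>
  proof -
    have "((\<lambda>\<theta>. Complex s \<theta>) has_derivative (\<lambda>h. \<i> * complex_of_real h)) (at \<theta> within {\<alpha>..\<beta>})"
      unfolding Complex_eq by (auto intro!: derivative_eq_intros)
    from has_derivative_compose [OF this F'(2)] V that
    show ?thesis
      by (auto simp: has_vector_derivative_def cscaleL_def blinfun_compose_simps)
  qed
  have ID: "(I has_vector_derivative D s) (at s within {a..b})" if s: "s \<in> {a..b}" for s
  proof -
    have "(I has_vector_derivative integral (cbox \<alpha> \<beta>) (\<lambda>\<theta>. F' (Complex s \<theta>))) (at s within {a..b})"
      unfolding I_def
    proof (rule leibniz_rule_vector_derivative [OF ds])
      show "(\<lambda>\<theta>. F (Complex s \<theta>)) integrable_on cbox \<alpha> \<beta>" if "s \<in> {a..b}" for s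
        using V that by (intro integrable_continuous continuous_on_compose2 [OF Fc] continuous_intros) auto
      show "continuous_on ({a..b} \<times> cbox \<alpha> \<beta>) (\<lambda>(s, \<theta>). F' (Complex s \<theta>))"
        unfolding split_beta using V
        by (intro continuous_on_compose2 [OF F'(1)] continuous_intros) auto
    qed (use s in auto)
    \<comment> \<open>By \<open>dt\<close>, i F' is the \<theta>-derivative of F, so the fundamental
      theorem evaluates the integral of F' after multiplication by \<open>J\<close>;
      \<open>J o\<^sub>L J = - id_blinfun\<close> then undoes that factor.\<close>
    moreover have "integral (cbox \<alpha> \<beta>) (\<lambda>\<theta>. F' (Complex s \<theta>)) = D s"
    proof -
      have int: "(\<lambda>\<theta>. F' (Complex s \<theta>)) integrable_on cbox \<alpha> \<beta>"
        using V s by (intro integrable_continuous continuous_on_compose2 [OF F'(1)] continuous_intros) auto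
      have "((\<lambda>\<theta>. J o\<^sub>L F' (Complex s \<theta>)) has_integral F (Complex s \<beta>) - F (Complex s \<alpha>)) {\<alpha>..\<beta>}"
        by (rule fundamental_theorem_of_calculus [OF ab(2)]) (use dt s in auto)
      moreover have "((\<lambda>\<theta>. J o\<^sub>L F' (Complex s \<theta>)) has_integral
          J o\<^sub>L integral (cbox \<alpha> \<beta>) (\<lambda>\<theta>. F' (Complex s \<theta>))) {\<alpha>..\<beta>}"
        using has_integral_linear [OF integrable_integral [OF int]
            bounded_bilinear.bounded_linear_right [OF bounded_bilinear_blinfun_compose]]
        by (simp add: o_def)
      ultimately have "J o\<^sub>L integral (cbox \<alpha> \<beta>) (\<lambda>\<theta>. F' (Complex s \<theta>)) = F (Complex s \<beta>) - F (Complex s \<alpha>)"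
        using has_integral_unique by blast
      then have "D s = - ((J o\<^sub>L J) o\<^sub>L integral (cbox \<alpha> \<beta>) (\<lambda>\<theta>. F' (Complex s \<theta>)))"
        by (simp add: D_def blinfun_compose_assoc)
      then show ?thesis
        by (simp add: blinfun_compose_complex_structure [OF J] blinfun_compose_simps)
    qed
    ultimately show ?thesis by simp
  qed
  have "(D has_integral (I b - I a)) (cbox a b)"
    using fundamental_theorem_of_calculus [OF ab(1) ID] by simp
  moreover have "norm (D s) \<le> B" if "s \<in> cbox a b" for s
  proof -
    have "norm (D s) \<le> cmod \<i> * norm (F (Complex s \<beta>) - F (Complex s \<alpha>))"
      unfolding D_def norm_minus_cancel using norm_cscaleL_compose_le [OF J, of \<i>] by simp
    then show ?thesis using B [of s] that by simp
  qed
  moreover have "0 \<le> B"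
    using order_trans [OF norm_ge_zero B [of a]] ab by simp
  ultimately have "norm (I b - I a) \<le> B * measure lborel (cbox a b)"
    by (intro has_integral_bound)
  then show ?thesis
    using ab by (simp add: I_def)
qed

text \<open>\<open>s\<close> is the logarithm of the radius. The measure is d\<theta> = dz/(iz), not
  dz, which is why the integrands below carry an extra factor z.\<close>

definition arc_integral :: "(complex \<Rightarrow> 'b::real_normed_vector) \<Rightarrow> real \<Rightarrow> real \<Rightarrow> real \<Rightarrow> 'b" where
  "arc_integral f s \<alpha> \<beta> = integral {\<alpha>..\<beta>} (\<lambda>\<theta>. f (exp (Complex s \<theta>)))"

lemma cauchy_arcs:
  fixes f :: "complex \<Rightarrow> 'a::banach \<Rightarrow>\<^sub>L 'a"
  assumes J: "complex_structure J" and f: "op_holomorphic_on J f V"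
    and ab: "a \<le> b" "\<alpha> \<le> \<beta>"
    and V: "\<And>s \<theta>. s \<in> {a..b} \<Longrightarrow> \<theta> \<in> {\<alpha>..\<beta>} \<Longrightarrow> exp (Complex s \<theta>) \<in> V"
    and B: "\<And>s. s \<in> {a..b} \<Longrightarrow> norm (f (exp (Complex s \<beta>)) - f (exp (Complex s \<alpha>))) \<le> B"
  shows "norm (arc_integral f b \<alpha> \<beta> - arc_integral f a \<alpha> \<beta>) \<le> B * (b - a)"
  unfolding arc_integral_def
  using cauchy_rectangle [OF J op_holomorphic_on_compose_exp [OF J f] ab] V B by simp

lemma exp_Complex_2pi: "exp (Complex s (\<theta> + 2 * pi)) = exp (Complex s \<theta>)"
  by (simp add: exp_eq_polar flip: cis_mult)

text \<open>The two radial sides coincide by periodicity, so \<open>cauchy_arcs\<close> applies with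
  bound 0.\<close>

lemma cauchy_circles:
  fixes f :: "complex \<Rightarrow> 'a::banach \<Rightarrow>\<^sub>L 'a"
  assumes J: "complex_structure J" and f: "op_holomorphic_on J f V" and ab: "a \<le> b"
    and V: "\<And>z. exp a \<le> cmod z \<Longrightarrow> cmod z \<le> exp b \<Longrightarrow> z \<in> V"
  shows "arc_integral f b \<alpha> (\<alpha> + 2 * pi) = arc_integral f a \<alpha> (\<alpha> + 2 * pi)"
proof -
  have "norm (arc_integral f b \<alpha> (\<alpha> + 2 * pi) - arc_integral f a \<alpha> (\<alpha> + 2 * pi)) \<le> 0 * (b - a)"
    by (rule cauchy_arcs [OF J f ab]) (auto simp: exp_Complex_2pi intro!: V)
  then show ?thesis by simp
qed

lemma continuous_on_arc:
  assumes "op_holomorphic_on J f V" "\<And>\<theta>. \<theta> \<in> {\<alpha>..\<beta>} \<Longrightarrow> exp (Complex s \<theta>) \<in> V"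
  shows "continuous_on {\<alpha>..\<beta>} (\<lambda>\<theta>. f (exp (Complex s \<theta>)))"
proof -
  have "continuous_on V f"
    by (rule op_holomorphic_onE [OF assms(1)])
  then show ?thesis
    by (rule continuous_on_compose2) (use assms(2) in \<open>auto intro!: continuous_intros continuous_on_Complex\<close>)
qed

text \<open>With \<open>A = 0\<close> this is the length estimate; a general \<open>A\<close> is
  used to find the limit of integrals over full circles.\<close>

lemma norm_arc_integral_le:
  fixes f :: "complex \<Rightarrow> 'a::banach \<Rightarrow>\<^sub>L 'a"
  assumes "op_holomorphic_on J f V" "\<And>\<theta>. \<theta> \<in> {\<alpha>..\<beta>} \<Longrightarrow> exp (Complex s \<theta>) \<in> V" "\<alpha> \<le> \<beta>"
    and "\<And>\<theta>. \<theta> \<in> {\<alpha>..\<beta>} \<Longrightarrow> norm (f (exp (Complex s \<theta>)) - A) \<le> B"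
  shows "norm (arc_integral f s \<alpha> \<beta> - (\<beta> - \<alpha>) *\<^sub>R A) \<le> B * (\<beta> - \<alpha>)"
proof -
  let ?g = "\<lambda>\<theta>. f (exp (Complex s \<theta>))"
  have c: "continuous_on {\<alpha>..\<beta>} ?g"
    using assms(1,2) by (rule continuous_on_arc)
  have "norm (integral {\<alpha>..\<beta>} (\<lambda>\<theta>. ?g \<theta> - A)) \<le> B * (\<beta> - \<alpha>)"
    using assms(3,4) c by (intro integral_bound continuous_intros) auto
  moreover have "integral {\<alpha>..\<beta>} (\<lambda>\<theta>. ?g \<theta> - A) = arc_integral f s \<alpha> \<beta> - (\<beta> - \<alpha>) *\<^sub>R A"
    using c assms(3) unfolding arc_integral_def
    by (subst Henstock_Kurzweil_Integration.integral_diff) (auto intro!: integrable_continuous_interval)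
  ultimately show ?thesis by simp
qed

lemma arc_integral_combine:
  fixes f :: "complex \<Rightarrow> 'a::banach \<Rightarrow>\<^sub>L 'a"
  assumes "op_holomorphic_on J f V" "\<And>\<theta>. \<theta> \<in> {\<alpha>..\<gamma>} \<Longrightarrow> exp (Complex s \<theta>) \<in> V" "\<alpha> \<le> \<beta>" "\<beta> \<le> \<gamma>"
  shows "arc_integral f s \<alpha> \<gamma> = arc_integral f s \<alpha> \<beta> + arc_integral f s \<beta> \<gamma>"
  unfolding arc_integral_def
  using assms by (intro Henstock_Kurzweil_Integration.integral_combine [symmetric]
      integrable_continuous_interval continuous_on_arc) auto

text \<open>The direction of \<open>b\<close> is left open: it serves for circles growing to
  infinity and for circles shrinking to 0.\<close>

lemma arc_integral_eq_limit:
  fixes f :: "complex \<Rightarrow> 'a::banach \<Rightarrow>\<^sub>L 'a"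
  assumes f: "op_holomorphic_on J f V"
    and lim: "\<And>e. e > 0 \<Longrightarrow> \<exists>b. arc_integral f a \<alpha> (\<alpha> + 2 * pi) = arc_integral f b \<alpha> (\<alpha> + 2 * pi) \<and>
      (\<forall>z. cmod z = exp b \<longrightarrow> z \<in> V \<and> norm (f z - A) \<le> e)"
  shows "arc_integral f a \<alpha> (\<alpha> + 2 * pi) = (2 * pi) *\<^sub>R A"
proof -
  let ?I = "arc_integral f a \<alpha> (\<alpha> + 2 * pi)"
  have "norm (?I - (2 * pi) *\<^sub>R A) \<le> 0 + e" if "e > 0" for e
  proof -
    have "e / (2 * pi) > 0" using that by simp
    from lim [OF this] obtain b where b: "?I = arc_integral f b \<alpha> (\<alpha> + 2 * pi)"
      "\<And>z. cmod z = exp b \<Longrightarrow> z \<in> V \<and> norm (f z - A) \<le> e / (2 * pi)" by blast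
    have "norm (arc_integral f b \<alpha> (\<alpha> + 2 * pi) - (\<alpha> + 2 * pi - \<alpha>) *\<^sub>R A) \<le> e / (2 * pi) * (\<alpha> + 2 * pi - \<alpha>)"
      by (rule norm_arc_integral_le [OF f]) (use b(2) in auto)
    then show ?thesis by (simp add: b(1))
  qed
  then have "norm (?I - (2 * pi) *\<^sub>R A) \<le> 0"
    by (rule field_le_epsilon)
  then show ?thesis by simp
qed

subsection \<open>The weight\<close>

definition newman_weight :: "real \<Rightarrow> complex \<Rightarrow> complex" where
  "newman_weight d z = (z - cis d) * (z - cis (- d)) / (z - 1)\<^sup>2"

lemma newman_weight_holomorphic: "newman_weight d holomorphic_on - {1}"
  unfolding newman_weight_def by (intro holomorphic_intros) auto

lemma newman_weight_tendsto: "(newman_weight d \<longlongrightarrow> 1) at_infinity"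
proof -
  have "filterlim (\<lambda>z. - 1 + z :: complex) at_infinity at_infinity"
    by (rule tendsto_add_filterlim_at_infinity [OF tendsto_const]) (rule filterlim_ident)
  from filterlim_compose [OF tendsto_inverse_0 this]
  have v: "((\<lambda>z. inverse (z - 1 :: complex)) \<longlongrightarrow> 0) at_infinity" by simp
  \<comment> \<open>Each factor (z - a)/(z - 1) of the weight is written as 1 + (1 - a)/(z -
    1).\<close>
  have "((\<lambda>z. (1 + (1 - cis d) * inverse (z - 1)) * (1 + (1 - cis (- d)) * inverse (z - 1)))
      \<longlongrightarrow> (1 + (1 - cis d) * 0) * (1 + (1 - cis (- d)) * 0)) at_infinity"
    by (intro tendsto_intros v)
  moreover have "\<forall>\<^sub>F z in at_infinity. (1 + (1 - cis d) * inverse (z - 1)) * (1 + (1 - cis (- d)) * inverse (z - 1))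
      = newman_weight d z"
  proof -
    have "(1 + (1 - cis d) * inverse (z - 1)) * (1 + (1 - cis (- d)) * inverse (z - 1)) = newman_weight d z"
      if "2 \<le> norm z" for z
    proof -
      have "z - 1 \<noteq> 0" using that by auto
      then show ?thesis
        unfolding newman_weight_def power2_eq_square by (simp add: field_simps)
    qed
    then show ?thesis unfolding eventually_at_infinity by blast
  qed
  ultimately show ?thesis using filterlim_cong [OF refl refl] by fastforce
qed

section \<open>Distances from 1 in logarithmic polar coordinates\<close>

lemma cmod_cis_minus_one_le: "cmod (cis \<theta> - 1) \<le> \<bar>\<theta>\<bar>"
proof -
  have "cmod (cis \<theta> - 1) = 2 * \<bar>sin (\<theta> / 2)\<bar>"
    using dist_exp_i_1 [of \<theta>] by (simp add: cis_conv_exp)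
  also have "\<dots> \<le> 2 * \<bar>\<theta> / 2\<bar>"
    using abs_sin_x_le_abs_x [of "\<theta> / 2"] by simp
  finally show ?thesis by simp
qed

lemma cmod_exp_Complex [simp]: "cmod (exp (Complex s \<theta>)) = exp s"
  by (simp add: exp_eq_polar norm_mult)

lemma exp_Complex_conv: "exp (Complex s \<theta>) = complex_of_real (exp s) * cis \<theta>"
  by (simp add: exp_eq_polar exp_of_real)

lemma cmod_exp_Complex_minus_cis: "cmod (exp (Complex s \<theta>) - cis \<theta>) = \<bar>exp s - 1\<bar>"
proof -
  have "exp (Complex s \<theta>) - cis \<theta> = complex_of_real (exp s - 1) * cis \<theta>"
    by (simp add: exp_Complex_conv algebra_simps)
  then show ?thesis by (simp only: norm_mult norm_of_real norm_cis mult_1_right)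
qed

lemma cmod_exp_Complex_minus_one_le: "cmod (exp (Complex s \<theta>) - 1) \<le> \<bar>exp s - 1\<bar> + \<bar>\<theta>\<bar>"
  using norm_triangle_ineq [of "exp (Complex s \<theta>) - cis \<theta>" "cis \<theta> - 1"]
    cmod_exp_Complex_minus_cis [of s \<theta>] cmod_cis_minus_one_le [of \<theta>] by simp

lemma cmod_exp_Complex_minus_one_ge: "\<bar>exp s - 1\<bar> \<le> cmod (exp (Complex s \<theta>) - 1)"
  using norm_triangle_ineq3 [of "exp (Complex s \<theta>)" 1] by simp

lemma abs_exp_minus_one_ge:
  fixes d :: real
  assumes "0 < d" "d \<le> 1" "\<bar>s\<bar> = d"
  shows "d / 2 \<le> \<bar>exp s - 1\<bar>"
proof (cases "s \<ge> 0")
  case True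
  then show ?thesis using assms exp_ge_add_one_self [of s] by linarith
next
  case False
  have "exp s = inverse (exp d)" using False assms by (simp flip: exp_minus)
  also have "\<dots> \<le> inverse (1 + d)"
    using assms exp_ge_add_one_self [of d] by (intro le_imp_inverse_le) auto
  finally have "1 - exp s \<ge> d / (1 + d)" using assms by (simp add: field_simps)
  moreover have "d / (1 + d) \<ge> d / 2"
    using assms by (intro divide_left_mono) auto
  ultimately show ?thesis by linarith
qed

lemma abs_exp_minus_one_le:
  fixes s :: real
  assumes "\<bar>s\<bar> \<le> 1"
  shows "\<bar>exp s - 1\<bar> \<le> 2 * \<bar>s\<bar>"
proof (cases "s \<ge> 0")
  case True
  then have "exp s \<le> 1 + s + s\<^sup>2" using assms exp_bound by auto
  moreover have "s\<^sup>2 \<le> s" using True assms by (simp add: power2_eq_square mult_left_le)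
  ultimately show ?thesis using True one_le_exp_iff [of s] by simp
next
  case False
  then have "exp s \<le> 1" by simp
  then show ?thesis using False exp_ge_add_one_self [of s] by linarith
qed

text \<open>A ray at angle at least d from the positive axis keeps distance sin d from 1, whatever
  \<open>s\<close> is: since cos \<theta> is at most cos d, |z - 1|^2 is at least (r - cos d)^2 +
  (sin d)^2.\<close>

lemma cmod_exp_Complex_minus_one_ge_angle:
  assumes d: "0 < d" "d \<le> 1" and t: "\<theta> \<in> {d..2 * pi - d}"
  shows "d / 2 \<le> cmod (exp (Complex s \<theta>) - 1)"
proof -
  have cos: "cos \<theta> \<le> cos d"
  proof (cases "\<theta> \<le> pi")
    case True
    then show ?thesis using d t by (intro cos_monotone_0_pi_le) auto
  next
    case False
    then have "cos (2 * pi - \<theta>) \<le> cos d" using d t by (intro cos_monotone_0_pi_le) auto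
    then show ?thesis by (simp add: cos_diff)
  qed
  let ?r = "exp s"
  have "(cmod (exp (Complex s \<theta>) - 1))\<^sup>2 = (?r * cos \<theta> - 1)\<^sup>2 + (?r * sin \<theta>)\<^sup>2"
    by (simp add: exp_Complex_conv cmod_power2 del: of_real_exp)
  also have "\<dots> = ?r\<^sup>2 * ((sin \<theta>)\<^sup>2 + (cos \<theta>)\<^sup>2) - 2 * ?r * cos \<theta> + 1"
    by algebra
  also have "\<dots> \<ge> ?r\<^sup>2 - 2 * ?r * cos d + 1"
    using cos by simp
  finally have "(cmod (exp (Complex s \<theta>) - 1))\<^sup>2 \<ge> ?r\<^sup>2 - 2 * ?r * cos d + 1" .
  moreover have "?r\<^sup>2 - 2 * ?r * cos d + 1 = (?r - cos d)\<^sup>2 + (sin d)\<^sup>2"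
    using sin_cos_squared_add [of d] by (simp only: power2_eq_square) (simp add: algebra_simps)
  moreover have "0 \<le> (?r - cos d)\<^sup>2" by simp
  ultimately have "(sin d)\<^sup>2 \<le> (cmod (exp (Complex s \<theta>) - 1))\<^sup>2"
    by linarith
  then have "sin d \<le> cmod (exp (Complex s \<theta>) - 1)"
    by (rule power2_le_imp_le) simp
  \<comment> \<open>Up to d, at most 1 and hence below pi/3, the cosine is at least 1/2, so sin x -
    x/2 is nondecreasing.\<close>
  moreover have "d / 2 \<le> sin d"
  proof -
    have "cos x \<ge> 1 / 2" if "0 \<le> x" "x \<le> d" for x
    proof -
      have "x \<le> pi / 3" using that d pi_gt3 by linarith
      then have "cos (pi / 3) \<le> cos x" using that by (intro cos_monotone_0_pi_le) auto
      then show ?thesis by (simp add: cos_60)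
    qed
    then have "sin 0 - 0 / 2 \<le> sin d - d / 2"
      using d by (intro DERIV_nonneg_imp_nondecreasing [of 0 d "\<lambda>x. sin x - x / 2"])
        (auto intro!: derivative_eq_intros exI conjI)
    then show ?thesis by simp
  qed
  ultimately show ?thesis by linarith
qed

text \<open>Put u = |z - 1|. Both zeros lie within d, hence within 2u, of 1, so each factor of the
  numerator is at most 3u. Estimating both gives 9; keeping one leaves 3/u, at most 6/d, times the
  distance to that zero.\<close>

lemma newman_weight_bounds:
  assumes d: "0 < d" "d / 2 \<le> cmod (z - 1)"
  shows "cmod (newman_weight d z) \<le> 9"
    and "cmod (newman_weight d z) \<le> 6 * cmod (z - cis d) / d"
    and "cmod (newman_weight d z) \<le> 6 * cmod (z - cis (- d)) / d"
proof -
  define u where "u = cmod (z - 1)"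
  have u: "u > 0" "d \<le> 2 * u" using d by (auto simp: u_def)
  have near: "cmod (z - cis e) \<le> 3 * u" if "\<bar>e\<bar> = d" for e
    using norm_triangle_ineq4 [of "z - 1" "cis e - 1"] cmod_cis_minus_one_le [of e] u that
    by (simp add: u_def)
  have a: "cmod (z - cis d) \<le> 3 * u" and b: "cmod (z - cis (- d)) \<le> 3 * u"
    using near d by auto
  have w: "cmod (newman_weight d z) = cmod (z - cis d) * cmod (z - cis (- d)) / u\<^sup>2"
    by (simp add: newman_weight_def norm_mult norm_divide norm_power u_def)
  have "cmod (z - cis d) * cmod (z - cis (- d)) \<le> (3 * u) * (3 * u)"
    using a b u by (intro mult_mono) auto
  then show "cmod (newman_weight d z) \<le> 9"
    using u by (simp add: w power2_eq_square divide_simps)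
  have aux: "x * y / u\<^sup>2 \<le> 6 * x / d" if "y \<le> 3 * u" "0 \<le> x" for x y
  proof -
    have "x * y / u\<^sup>2 \<le> x * (3 * u) / u\<^sup>2"
      using that by (intro divide_right_mono mult_left_mono) auto
    also have "\<dots> = 6 * x / (2 * u)"
      using u by (simp add: power2_eq_square)
    also have "\<dots> \<le> 6 * x / d"
      using u d that by (intro divide_left_mono) auto
    finally show ?thesis .
  qed
  show "cmod (newman_weight d z) \<le> 6 * cmod (z - cis d) / d"
    unfolding w using b by (rule aux) simp
  show "cmod (newman_weight d z) \<le> 6 * cmod (z - cis (- d)) / d"
    unfolding w mult.commute [of "cmod (z - cis d)"] using a by (rule aux) simp
qed

text \<open>Angle -d lies outside the range of the previous ray estimate, but 2 pi - d is the same
  ray.\<close>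

lemma cmod_leg_minus_one_ge:
  assumes d: "0 < d" "d \<le> 1" and t: "\<bar>\<theta>\<bar> = d"
  shows "d / 2 \<le> cmod (exp (Complex s \<theta>) - 1)"
proof (cases "\<theta> = d")
  case True
  then show ?thesis using d pi_gt3 by (intro cmod_exp_Complex_minus_one_ge_angle) auto
next
  case False
  then have "\<theta> = - d" using t by linarith
  then have "exp (Complex s \<theta>) = exp (Complex s (2 * pi - d))"
    using exp_Complex_2pi [of s "- d"] by (simp add: add.commute)
  moreover have "d / 2 \<le> cmod (exp (Complex s (2 * pi - d)) - 1)"
    using d pi_gt3 by (intro cmod_exp_Complex_minus_one_ge_angle) auto
  ultimately show ?thesis by simp
qed

text \<open>On the rays through its zeros the weight vanishes linearly at the unit circle, which
  cancels the pole of the bound K/||z| - 1|.\<close>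

lemma newman_weight_leg:
  assumes d: "0 < d" "d \<le> 1" and t: "\<bar>\<theta>\<bar> = d"
  shows "cmod (newman_weight d (exp (Complex s \<theta>))) \<le> 6 * \<bar>exp s - 1\<bar> / d"
proof -
  note b = newman_weight_bounds(2,3) [OF d(1) cmod_leg_minus_one_ge [OF d t, of s]]
  consider "\<theta> = d" | "\<theta> = - d" using t by linarith
  then show ?thesis
    using b cmod_exp_Complex_minus_cis [of s \<theta>] by cases auto
qed

text \<open>The factor after \<open>cmod z\<close> is the common shape of the operator bounds on
  both sides of the circle. With x = |exp s - 1| it is at most (2x + d)/x. On the arcs d is at most
  2x, giving 9 * 3 * 4 = 108; on the rays the weight bound 6x/d cancels x, and x at most 2d gives 18
  * 5 = 90.\<close>

lemma newman_weight_near: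
  assumes d: "0 < d" "d \<le> 1"
    and cases: "\<bar>s\<bar> = d \<and> \<bar>\<theta>\<bar> \<le> d \<or> s \<noteq> 0 \<and> \<bar>s\<bar> \<le> d \<and> \<bar>\<theta>\<bar> = d"
  defines "z \<equiv> exp (Complex s \<theta>)"
  shows "cmod (newman_weight d z) * cmod z * (1 + cmod (z - 1) / \<bar>cmod z - 1\<bar>) \<le> 108"
proof -
  define x where "x = \<bar>exp s - 1\<bar>"
  have x: "x > 0" using cases d by (auto simp: x_def)
  have z3: "cmod z \<le> 3"
  proof -
    have "exp s \<le> exp (1::real)" using cases d by auto
    then show ?thesis using exp_le by (simp add: z_def del: exp_le_cancel_iff)
  qed
  have zx: "cmod (z - 1) \<le> x + d"
    using cmod_exp_Complex_minus_one_le [of s \<theta>] cases by (auto simp: z_def x_def)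
  have q: "1 + cmod (z - 1) / \<bar>cmod z - 1\<bar> \<le> (2 * x + d) / x"
  proof -
    have "cmod (z - 1) / x \<le> (x + d) / x"
      using zx x by (intro divide_right_mono) auto
    then have "1 + cmod (z - 1) / x \<le> 1 + (x + d) / x" by simp
    also have "\<dots> = (2 * x + d) / x" using x by (simp add: field_simps)
    finally show ?thesis by (simp add: z_def x_def)
  qed
  have pos: "0 \<le> 1 + cmod (z - 1) / \<bar>cmod z - 1\<bar>" by (intro add_nonneg_nonneg) auto
  from cases show ?thesis
  proof
    assume c: "\<bar>s\<bar> = d \<and> \<bar>\<theta>\<bar> \<le> d"
    have xd: "d / 2 \<le> x" unfolding x_def using d c by (intro abs_exp_minus_one_ge) auto
    have "d / 2 \<le> cmod (z - 1)"
      using xd cmod_exp_Complex_minus_one_ge [of s \<theta>] by (simp add: x_def z_def)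
    then have w: "cmod (newman_weight d z) \<le> 9"
      using newman_weight_bounds d by blast
    have "(2 * x + d) / x \<le> 4" using x xd by (simp add: divide_simps)
    then have "cmod (newman_weight d z) * cmod z * (1 + cmod (z - 1) / \<bar>cmod z - 1\<bar>) \<le> 9 * 3 * 4"
      using w z3 q pos by (intro mult_mono) auto
    then show ?thesis by simp
  next
    assume c: "s \<noteq> 0 \<and> \<bar>s\<bar> \<le> d \<and> \<bar>\<theta>\<bar> = d"
    have w: "cmod (newman_weight d z) \<le> 6 * x / d"
      unfolding z_def x_def using d c by (intro newman_weight_leg) auto
    have "x \<le> 2 * \<bar>s\<bar>" unfolding x_def using c d by (intro abs_exp_minus_one_le) auto
    then have xd: "x \<le> 2 * d" using c by linarith
    have "cmod (newman_weight d z) * cmod z * (1 + cmod (z - 1) / \<bar>cmod z - 1\<bar>)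
        \<le> (6 * x / d) * 3 * ((2 * x + d) / x)"
      using w z3 q pos x d by (intro mult_mono mult_nonneg_nonneg) auto
    also have "\<dots> = 18 * (2 * x + d) / d" using x d by (simp add: field_simps)
    also have "\<dots> \<le> 108" using xd d by (simp add: divide_simps)
    finally show ?thesis .
  qed
qed

subsection \<open>Contour integrals for a power-bounded operator\<close>

text \<open>The quotient (z^n - T^n)/(z - T), that is, the sum of z^(n-1-k) T^k over k < n, in
  Horner form; being a polynomial in z, it makes sense on the spectrum too.\<close>

primrec op_geometric :: "('a::real_normed_vector \<Rightarrow>\<^sub>L 'a) \<Rightarrow> ('a \<Rightarrow>\<^sub>L 'a) \<Rightarrow> nat \<Rightarrow> complex \<Rightarrow> ('a \<Rightarrow>\<^sub>L 'a)" where
  "op_geometric J T 0 z = 0"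
| "op_geometric J T (Suc n) z = (cscaleL J z o\<^sub>L op_geometric J T n z) + op_pow T n"

locale power_bounded_operator =
  fixes J T :: "'a::banach \<Rightarrow>\<^sub>L 'a" and K :: real
  assumes J: "complex_structure J" and T: "clinear_op J T"
    and K1: "1 \<le> K" and K: "norm (op_pow T n) \<le> K"
begin

abbreviation "\<sigma> \<equiv> op_spectrum J T"
abbreviation "R z \<equiv> resolvent J z T"
abbreviation "X n \<equiv> op_pow T n o\<^sub>L (id_blinfun - T)"
abbreviation "P n z \<equiv> op_geometric J T n z"

section \<open>Operator bounds outside and inside the unit disc\<close>

lemma T_le: "norm T \<le> K"
  using K [of 1] by (simp add: op_pow_Suc)

lemma clinear_X: "clinear_op J (X n)"
  by (intro clinear_op_compose clinear_op_op_pow clinear_op_diff T clinear_op_id)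

lemma P_eq: "(cscaleL J z - T) o\<^sub>L P n z = cscaleL J (z ^ n) - op_pow T n"
proof (induction n)
  case (Suc n)
  have "(cscaleL J z - T) o\<^sub>L P (Suc n) z =
      (((cscaleL J z - T) o\<^sub>L cscaleL J z) o\<^sub>L P n z) + ((cscaleL J z - T) o\<^sub>L op_pow T n)"
    by (simp add: blinfun_compose_simps)
  also have "(cscaleL J z - T) o\<^sub>L cscaleL J z = cscaleL J z o\<^sub>L (cscaleL J z - T)"
    by (rule cscaleL_commute) (simp add: clinear_op_diff T)
  also have "((cscaleL J z o\<^sub>L (cscaleL J z - T)) o\<^sub>L P n z) + ((cscaleL J z - T) o\<^sub>L op_pow T n)
      = (cscaleL J z o\<^sub>L ((cscaleL J z - T) o\<^sub>L P n z)) + ((cscaleL J z - T) o\<^sub>L op_pow T n)"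
    by (simp only: blinfun_compose_assoc)
  also have "\<dots> = (cscaleL J z o\<^sub>L (cscaleL J (z ^ n) - op_pow T n)) + ((cscaleL J z - T) o\<^sub>L op_pow T n)"
    by (simp only: Suc)
  also have "\<dots> = cscaleL J (z ^ Suc n) - op_pow T (Suc n)"
    by (simp add: op_pow_Suc cscaleL_mult [OF J] bounded_bilinear.diff_left [OF bounded_bilinear_blinfun_compose]
        bounded_bilinear.diff_right [OF bounded_bilinear_blinfun_compose])
  finally show ?case .
qed simp

text \<open>A finite geometric sum is dominated by the full series, uniformly in n; K/(1 - |z|) is
  the fixed point of the recursion x = |z| x + K.\<close>

lemma norm_P_le: "cmod z < 1 \<Longrightarrow> norm (P n z) \<le> K / (1 - cmod z)"
proof (induction n)
  case 0
  then show ?case using K1 by simp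
next
  case (Suc n)
  have "norm (P (Suc n) z) \<le> norm (cscaleL J z o\<^sub>L P n z) + norm (op_pow T n)"
    by (simp add: norm_triangle_ineq)
  also have "\<dots> \<le> cmod z * (K / (1 - cmod z)) + K"
    using Suc by (intro add_mono K order_trans [OF norm_cscaleL_compose_le [OF J]] mult_left_mono) auto
  also have "\<dots> = K / (1 - cmod z)" using Suc.prems by (simp add: field_simps)
  finally show ?case .
qed

lemma P_commute: "P n z o\<^sub>L T = T o\<^sub>L P n z"
proof (induction n)
  case (Suc n)
  have "(cscaleL J z o\<^sub>L P n z) o\<^sub>L T = (cscaleL J z o\<^sub>L T) o\<^sub>L P n z"
    by (simp add: Suc blinfun_compose_assoc)
  also have "\<dots> = T o\<^sub>L (cscaleL J z o\<^sub>L P n z)"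
    by (simp only: cscaleL_commute [OF T, symmetric] blinfun_compose_assoc)
  finally show ?case
    by (simp add: op_pow_commute [of T T, symmetric]
        bounded_bilinear.add_left [OF bounded_bilinear_blinfun_compose]
        bounded_bilinear.add_right [OF bounded_bilinear_blinfun_compose])
qed simp

lemma P_holomorphic: "op_holomorphic_on J (P n) UNIV"
proof (induction n)
  case 0
  then show ?case
    using op_holomorphic_on_const [of J 0 UNIV] by (simp add: clinear_op_def)
next
  case (Suc n)
  have "op_holomorphic_on J (\<lambda>z. (cscaleL J z o\<^sub>L P n z) + op_pow T n) UNIV"
    by (intro op_holomorphic_on_add op_holomorphic_on_compose op_holomorphic_on_cscaleL J Suc
        op_holomorphic_on_const clinear_op_op_pow T) (auto intro: holomorphic_intros)
  then show ?case by simp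
qed

text \<open>Power-boundedness controls T^n, and (I - T)R = I - (z - 1)R with R at most K/(|z| - 1)
  controls the rest. The absolute value in the denominator gives the same form as the estimate
  inside the disc.\<close>

lemma norm_X_R_le:
  assumes z: "cmod z > 1"
  shows "norm (X n o\<^sub>L R z) \<le> 2 * K\<^sup>2 * (1 + cmod (z - 1) / \<bar>cmod z - 1\<bar>)"
proof -
  define q where "q = cmod (z - 1) / \<bar>cmod z - 1\<bar>"
  have q: "q \<ge> 0" by (simp add: q_def)
  have z': "z \<notin> \<sigma>" "norm (R z) \<le> K / (cmod z - 1)"
    using resolvent_outside_disc [OF J T K z] by auto
  have "norm ((id_blinfun - T) o\<^sub>L R z) \<le> norm (id_blinfun :: 'a \<Rightarrow>\<^sub>L 'a) + norm (cscaleL J (z - 1) o\<^sub>L R z)"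
    unfolding id_minus_compose_resolvent [OF T z'(1)] by (rule norm_triangle_ineq4)
  also have "\<dots> \<le> 1 + cmod (z - 1) * (K / (cmod z - 1))"
    using z' by (intro add_mono norm_blinfun_id_le order_trans [OF norm_cscaleL_compose_le [OF J]] mult_left_mono) auto
  also have "\<dots> = 1 + q * K" using z by (simp add: q_def)
  finally have 1: "norm ((id_blinfun - T) o\<^sub>L R z) \<le> 1 + q * K" .
  have "norm (X n o\<^sub>L R z) \<le> norm (op_pow T n) * norm ((id_blinfun - T) o\<^sub>L R z)"
    unfolding blinfun_compose_assoc by (rule norm_blinfun_compose)
  also have "\<dots> \<le> K * (1 + q * K)"
    using K1 K 1 by (intro mult_mono) auto
  also have "\<dots> \<le> 2 * K\<^sup>2 * (1 + q)"
  proof -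
    have "K \<le> K\<^sup>2" using K1 by (simp add: power2_eq_square)
    moreover have "0 \<le> q * K\<^sup>2" using q by simp
    ultimately have "K + q * K\<^sup>2 \<le> 2 * K\<^sup>2 + 2 * (q * K\<^sup>2)" using K1 by linarith
    then show ?thesis by (simp add: power2_eq_square algebra_simps)
  qed
  finally show ?thesis by (simp add: q_def)
qed

text \<open>Writing I - T = (z - T) - (z - 1) turns the product into z^n - T^n - (z - 1)P(z), the
  counterpart inside the disc of the splitting used for the resolvent.\<close>

lemma norm_P_id_minus_le:
  assumes z: "cmod z < 1"
  shows "norm (P n z o\<^sub>L (id_blinfun - T)) \<le> 2 * K\<^sup>2 * (1 + cmod (z - 1) / \<bar>cmod z - 1\<bar>)"
proof -
  define q where "q = cmod (z - 1) / \<bar>cmod z - 1\<bar>"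
  have q: "q \<ge> 0" by (simp add: q_def)
  have "P n z o\<^sub>L (id_blinfun - T) = ((cscaleL J z - T) o\<^sub>L P n z) - (cscaleL J (z - 1) o\<^sub>L P n z)"
    by (simp add: cscaleL_diff P_commute bounded_bilinear.diff_left [OF bounded_bilinear_blinfun_compose]
        bounded_bilinear.diff_right [OF bounded_bilinear_blinfun_compose])
  then have "norm (P n z o\<^sub>L (id_blinfun - T)) \<le> norm (cscaleL J (z ^ n) - op_pow T n) + norm (cscaleL J (z - 1) o\<^sub>L P n z)"
    unfolding P_eq by (simp add: norm_triangle_ineq4)
  also have "\<dots> \<le> (1 + K) + cmod (z - 1) * (K / (1 - cmod z))"
  proof (intro add_mono)
    have "norm (cscaleL J (z ^ n)) \<le> cmod z ^ n"
      using norm_cscaleL_le [OF J, of "z ^ n"] by (simp add: norm_power)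
    also have "\<dots> \<le> 1" using z by (simp add: power_le_one)
    finally show "norm (cscaleL J (z ^ n) - op_pow T n) \<le> 1 + K"
      using norm_triangle_ineq4 [of "cscaleL J (z ^ n)" "op_pow T n"] K [of n] by linarith
    show "norm (cscaleL J (z - 1) o\<^sub>L P n z) \<le> cmod (z - 1) * (K / (1 - cmod z))"
      using norm_P_le [OF z]
      by (intro order_trans [OF norm_cscaleL_compose_le [OF J]] mult_left_mono) auto
  qed
  also have "\<dots> = 1 + K + q * K" using z by (simp add: q_def)
  also have "\<dots> \<le> 2 * K\<^sup>2 * (1 + q)"
  proof -
    have K2: "K \<le> K\<^sup>2" using K1 by (simp add: power2_eq_square)
    moreover have "1 \<le> K\<^sup>2" using K1 K2 by linarith
    moreover have "q * K \<le> q * K\<^sup>2" using q K2 by (intro mult_left_mono)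
    moreover have "0 \<le> q * K\<^sup>2" using q by simp
    ultimately show ?thesis by (simp add: algebra_simps)
  qed
  finally show ?thesis by (simp add: q_def)
qed

text \<open>The first integrand is the second minus the third. The second may be continued inwards
  as far as the resolvent and gains |z|^n there; the third is holomorphic off 1. The factor z
  converts d\<theta> to dz.\<close>

definition "outer_integrand d n z = cscaleL J (newman_weight d z * z) o\<^sub>L (X n o\<^sub>L R z)"
definition "analytic_integrand d n z = cscaleL J (newman_weight d z * z * z ^ n) o\<^sub>L ((id_blinfun - T) o\<^sub>L R z)"
definition "inner_integrand d n z = cscaleL J (newman_weight d z * z) o\<^sub>L (P n z o\<^sub>L (id_blinfun - T))"

section \<open>Holomorphy, bounds and full-circle integrals of the integrands\<close>

lemma open_domain: "open (- \<sigma> - {1})"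
  by (intro open_Diff open_resolvent_set J T) auto

lemma outer_holomorphic: "op_holomorphic_on J (outer_integrand d n) (- \<sigma> - {1})"
  unfolding outer_integrand_def
  by (intro op_holomorphic_on_compose op_holomorphic_on_cscaleL J open_domain
      op_holomorphic_on_const clinear_X op_holomorphic_on_subset [OF op_holomorphic_on_resolvent [OF J T]]
      holomorphic_intros holomorphic_on_subset [OF newman_weight_holomorphic]) auto

lemma analytic_holomorphic: "op_holomorphic_on J (analytic_integrand d n) (- \<sigma> - {1})"
  unfolding analytic_integrand_def
  by (intro op_holomorphic_on_compose op_holomorphic_on_cscaleL J open_domain
      op_holomorphic_on_const clinear_op_diff T clinear_op_id op_holomorphic_on_subset [OF op_holomorphic_on_resolvent [OF J T]]
      holomorphic_intros holomorphic_on_subset [OF newman_weight_holomorphic]) auto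

lemma inner_holomorphic: "op_holomorphic_on J (inner_integrand d n) (- {1})"
  unfolding inner_integrand_def
  by (intro op_holomorphic_on_compose op_holomorphic_on_cscaleL J
      op_holomorphic_on_const clinear_op_diff T clinear_op_id op_holomorphic_on_subset [OF P_holomorphic]
      holomorphic_intros holomorphic_on_subset [OF newman_weight_holomorphic]) auto

text \<open>Multiplying \<open>P_eq\<close> by the resolvent gives P = z^n R - T^n R, and R commutes
  with T.\<close>

lemma outer_eq:
  assumes "z \<notin> \<sigma>"
  shows "outer_integrand d n z = analytic_integrand d n z - inner_integrand d n z"
proof -
  let ?D = "id_blinfun - T"
  have RT: "R z o\<^sub>L T = T o\<^sub>L R z" by (rule resolvent_commute [OF T assms])
  then have RD: "R z o\<^sub>L ?D = ?D o\<^sub>L R z"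
    by (simp add: bounded_bilinear.diff_left [OF bounded_bilinear_blinfun_compose]
        bounded_bilinear.diff_right [OF bounded_bilinear_blinfun_compose])
  have "P n z = (R z o\<^sub>L (cscaleL J z - T)) o\<^sub>L P n z"
    using resolvent_inverse(1) [OF assms] by simp
  also have "\<dots> = R z o\<^sub>L (cscaleL J (z ^ n) - op_pow T n)"
    by (simp only: blinfun_compose_assoc P_eq)
  also have "\<dots> = (cscaleL J (z ^ n) o\<^sub>L R z) - (op_pow T n o\<^sub>L R z)"
    by (simp add: bounded_bilinear.diff_right [OF bounded_bilinear_blinfun_compose]
        cscaleL_commute [OF clinear_op_resolvent [OF T assms]] op_pow_commute [OF RT])
  finally have "P n z o\<^sub>L ?D = (cscaleL J (z ^ n) o\<^sub>L (?D o\<^sub>L R z)) - (X n o\<^sub>L R z)"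
    by (simp add: bounded_bilinear.diff_left [OF bounded_bilinear_blinfun_compose, of _ _ ?D] blinfun_compose_assoc RD)
  then show ?thesis
    unfolding outer_integrand_def analytic_integrand_def inner_integrand_def
    by (simp add: cscaleL_mult [OF J, of _ "z ^ n"] blinfun_compose_assoc
        bounded_bilinear.diff_right [OF bounded_bilinear_blinfun_compose, of "cscaleL J (newman_weight d z * z)"])
qed

lemma norm_weighted_le:
  assumes "norm G \<le> 2 * K\<^sup>2 * (1 + cmod (z - 1) / \<bar>cmod z - 1\<bar>)"
    and "cmod (newman_weight d z) * cmod z * (1 + cmod (z - 1) / \<bar>cmod z - 1\<bar>) \<le> 108"
  shows "norm (cscaleL J (newman_weight d z * z) o\<^sub>L G) \<le> 216 * K\<^sup>2"
proof -
  let ?q = "1 + cmod (z - 1) / \<bar>cmod z - 1\<bar>"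
  have "norm (cscaleL J (newman_weight d z * z) o\<^sub>L G) \<le> cmod (newman_weight d z * z) * (2 * K\<^sup>2 * ?q)"
    using assms(1) by (intro order_trans [OF norm_cscaleL_compose_le [OF J]] mult_left_mono) auto
  also have "\<dots> = 2 * K\<^sup>2 * (cmod (newman_weight d z) * cmod z * ?q)"
    by (simp only: norm_mult mult.assoc mult.left_commute mult.commute)
  also have "\<dots> \<le> 2 * K\<^sup>2 * 108"
    using assms(2) by (intro mult_left_mono) auto
  finally show ?thesis by simp
qed

text \<open>Covers the outer near arc and the two radial legs that join it to the unit
  circle.\<close>

lemma outer_bound:
  assumes d: "0 < d" "d \<le> 1"
    and cases: "s = d \<and> \<bar>\<theta>\<bar> \<le> d \<or> 0 \<le> s \<and> s \<le> d \<and> \<bar>\<theta>\<bar> = d"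
  shows "norm (outer_integrand d n (exp (Complex s \<theta>))) \<le> 216 * K\<^sup>2"
proof (cases "s = 0")
  case True
  then have "\<bar>\<theta>\<bar> = d" using cases d by auto
  then have "newman_weight d (exp (Complex s \<theta>)) = 0"
    using newman_weight_leg [OF d, of \<theta> s] True by simp
  then show ?thesis by (simp add: outer_integrand_def)
next
  case False
  then have "s > 0" using cases d by auto
  then show ?thesis
    unfolding outer_integrand_def using cases d
    by (intro norm_weighted_le norm_X_R_le newman_weight_near) auto
qed

text \<open>The mirror image inside the disc, with the polynomial estimate in place of the resolvent
  estimate.\<close>

lemma inner_bound:
  assumes d: "0 < d" "d \<le> 1"
    and cases: "s = - d \<and> \<bar>\<theta>\<bar> \<le> d \<or> - d \<le> s \<and> s \<le> 0 \<and> \<bar>\<theta>\<bar> = d"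
  shows "norm (inner_integrand d n (exp (Complex s \<theta>))) \<le> 216 * K\<^sup>2"
proof (cases "s = 0")
  case True
  then have "\<bar>\<theta>\<bar> = d" using cases d by auto
  then have "newman_weight d (exp (Complex s \<theta>)) = 0"
    using newman_weight_leg [OF d, of \<theta> s] True by simp
  then show ?thesis by (simp add: inner_integrand_def)
next
  case False
  then have "s < 0" using cases d by auto
  then show ?thesis
    unfolding inner_integrand_def using cases d
    by (intro norm_weighted_le norm_P_id_minus_le newman_weight_near) auto
qed

text \<open>The factor z cancels the decay of the resolvent: z R(z) = I + T R(z) tends to I, and the
  weight tends to 1.\<close>

lemma outer_tendsto: "(outer_integrand d n \<longlongrightarrow> X n) at_infinity"
proof -
  have Rb: "z \<notin> \<sigma> \<and> norm (R z) \<le> K / (cmod z - 1)" if "2 \<le> cmod z" for z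
    using resolvent_outside_disc [OF J T K, of z] that by auto
  have "filterlim (\<lambda>z :: complex. - 1 + cmod z) at_top at_infinity"
    by (rule filterlim_tendsto_add_at_top [OF tendsto_const filterlim_norm_at_top])
  then have "filterlim (\<lambda>z :: complex. - 1 + cmod z) at_infinity at_infinity"
    by (rule filterlim_at_top_imp_at_infinity)
  from tendsto_divide_0 [OF tendsto_const this, of K]
  have K0: "((\<lambda>z :: complex. K / (cmod z - 1)) \<longlongrightarrow> 0) at_infinity" by simp
  have R0: "((\<lambda>z. R z) \<longlongrightarrow> 0) at_infinity"
    by (rule Lim_null_comparison [OF _ K0]) (use Rb in \<open>unfold eventually_at_infinity, blast\<close>)
  have w: "((\<lambda>z. cscaleL J (newman_weight d z)) \<longlongrightarrow> cscaleL J 1) at_infinity"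
    unfolding cscaleL_def by (intro tendsto_intros newman_weight_tendsto)
  have "((\<lambda>z. cscaleL J (newman_weight d z) o\<^sub>L (X n o\<^sub>L (id_blinfun + (T o\<^sub>L R z))))
      \<longlongrightarrow> cscaleL J 1 o\<^sub>L (X n o\<^sub>L (id_blinfun + (T o\<^sub>L 0)))) at_infinity"
    by (intro tendsto_intros w R0)
  then have lim: "((\<lambda>z. cscaleL J (newman_weight d z) o\<^sub>L (X n o\<^sub>L (id_blinfun + (T o\<^sub>L R z)))) \<longlongrightarrow> X n) at_infinity"
    by simp
  have eq: "cscaleL J (newman_weight d z) o\<^sub>L (X n o\<^sub>L (id_blinfun + (T o\<^sub>L R z))) = outer_integrand d n z"
    if z: "z \<notin> \<sigma>" for z
  proof -
    have "id_blinfun + (T o\<^sub>L R z) = cscaleL J z o\<^sub>L R z"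
      using resolvent_inverse(2) [OF z]
      by (simp add: bounded_bilinear.diff_left [OF bounded_bilinear_blinfun_compose] algebra_simps)
    then have "X n o\<^sub>L (id_blinfun + (T o\<^sub>L R z)) = (X n o\<^sub>L cscaleL J z) o\<^sub>L R z"
      by (simp only: blinfun_compose_assoc)
    also have "\<dots> = (cscaleL J z o\<^sub>L X n) o\<^sub>L R z"
      by (simp only: cscaleL_commute [OF clinear_X])
    finally show ?thesis
      by (simp add: outer_integrand_def cscaleL_mult [OF J] blinfun_compose_assoc)
  qed
  have "\<forall>\<^sub>F z in at_infinity. cscaleL J (newman_weight d z) o\<^sub>L (X n o\<^sub>L (id_blinfun + (T o\<^sub>L R z))) = outer_integrand d n z"
    unfolding eventually_at_infinity using Rb eq by blast
  from tendsto_cong [OF this] lim show ?thesis by blast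
qed

text \<open>All circles outside the closed unit disc give the same integral; let the radius grow.
  The free starting angle will be -d, so that the near arc becomes an interval of angles.\<close>

lemma outer_circle:
  assumes "0 < a"
  shows "arc_integral (outer_integrand d n) a \<alpha> (\<alpha> + 2 * pi) = (2 * pi) *\<^sub>R X n"
proof (rule arc_integral_eq_limit [OF outer_holomorphic])
  fix e :: real assume "e > 0"
  with outer_tendsto have "\<forall>\<^sub>F z in at_infinity. dist (outer_integrand d n z) (X n) < e"
    by (rule tendstoD)
  then obtain B where B: "\<And>z. B \<le> cmod z \<Longrightarrow> dist (outer_integrand d n z) (X n) < e"
    unfolding eventually_at_infinity by blast
  \<comment> \<open>Large enough to exceed \<open>a\<close> and to make \<open>exp b\<close> at
    least \<open>B\<close>; the inner maximum keeps the argument of the logarithm positive.\<close>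
  define b where "b = max a (ln (max B 1))"
  have dom: "z \<in> - \<sigma> - {1}" if "exp a \<le> cmod z" for z
  proof -
    have "1 < cmod z" using that assms one_less_exp_iff [of a] by linarith
    then show ?thesis using resolvent_outside_disc(1) [OF J T K] by auto
  qed
  have "B \<le> exp (ln (max B 1))" by simp
  also have "\<dots> \<le> exp b" unfolding b_def by (subst exp_le_cancel_iff) simp
  finally have Bb: "B \<le> exp b" .
  have ab: "a \<le> b" by (simp add: b_def)
  have "arc_integral (outer_integrand d n) b \<alpha> (\<alpha> + 2 * pi) = arc_integral (outer_integrand d n) a \<alpha> (\<alpha> + 2 * pi)"
    by (rule cauchy_circles [OF J outer_holomorphic ab]) (use dom in blast)
  moreover have "z \<in> - \<sigma> - {1} \<and> norm (outer_integrand d n z - X n) \<le> e" if "cmod z = exp b" for z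
    using dom [of z] B [of z] Bb ab that by (simp add: dist_norm less_imp_le)
  ultimately show "\<exists>b. arc_integral (outer_integrand d n) a \<alpha> (\<alpha> + 2 * pi) = arc_integral (outer_integrand d n) b \<alpha> (\<alpha> + 2 * pi) \<and>
      (\<forall>z. cmod z = exp b \<longrightarrow> z \<in> - \<sigma> - {1} \<and> norm (outer_integrand d n z - X n) \<le> e)"
    by metis
qed

text \<open>The integrand has no singularity inside the disc; let the radius shrink to 0.\<close>

lemma inner_circle:
  assumes "a < 0"
  shows "arc_integral (inner_integrand d n) a \<alpha> (\<alpha> + 2 * pi) = 0"
proof -
  have "arc_integral (inner_integrand d n) a \<alpha> (\<alpha> + 2 * pi) = (2 * pi) *\<^sub>R 0"
  proof (rule arc_integral_eq_limit [OF inner_holomorphic])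
    fix e :: real assume "e > 0"
    have "continuous_on (- {1}) (inner_integrand d n)"
      by (rule op_holomorphic_onE [OF inner_holomorphic])
    then have "isCont (inner_integrand d n) 0"
      by (rule continuous_on_interior) (simp add: interior_open open_Compl)
    then obtain r where r: "r > 0" "\<And>z. dist z 0 < r \<Longrightarrow> dist (inner_integrand d n z) (inner_integrand d n 0) < e"
      using \<open>e > 0\<close> unfolding continuous_at_eps_delta by metis
    \<comment> \<open>The factor z makes the integrand vanish at 0.\<close>
    have r': "norm (inner_integrand d n z) < e" if "cmod z < r" for z
      using r(2) [of z] that by (simp add: inner_integrand_def)
    define b where "b = min a (ln (r / 2))"
    have dom: "z \<in> - {1}" if "cmod z \<le> exp a" for z
      using that assms exp_less_one_iff [of a] by auto
    have ba: "b \<le> a" by (simp add: b_def)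
    have "exp b \<le> exp (ln (r / 2))" unfolding b_def by (subst exp_le_cancel_iff) simp
    then have br: "exp b < r" using r(1) by simp
    have "arc_integral (inner_integrand d n) a \<alpha> (\<alpha> + 2 * pi) = arc_integral (inner_integrand d n) b \<alpha> (\<alpha> + 2 * pi)"
      by (rule cauchy_circles [OF J inner_holomorphic ba]) (use dom in blast)
    moreover have "z \<in> - {1} \<and> norm (inner_integrand d n z - 0) \<le> e" if "cmod z = exp b" for z
      using dom [of z] r' [of z] br ba that by (simp add: less_imp_le)
    ultimately show "\<exists>b. arc_integral (inner_integrand d n) a \<alpha> (\<alpha> + 2 * pi) = arc_integral (inner_integrand d n) b \<alpha> (\<alpha> + 2 * pi) \<and>
        (\<forall>z. cmod z = exp b \<longrightarrow> z \<in> - {1} \<and> norm (inner_integrand d n z - 0) \<le> e)"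
      by metis
  qed
  then show ?thesis by simp
qed

end

section \<open>Estimates for fixed n; \<open>M\<close> stands for \<open>m d\<close>, so the last
  hypothesis below says \<open>m_log m d = c * real n\<close>\<close>

context power_bounded_operator
begin

context
  fixes c d M :: real and n :: nat
  assumes c: "0 < c" "c < 1" and d: "0 < d" "d \<le> 1" and M: "1 / d \<le> M"
    and res: "\<And>\<theta>. \<theta> \<in> {d..2 * pi - d} \<Longrightarrow> cis \<theta> \<notin> \<sigma> \<and> norm (R (cis \<theta>)) \<le> M"
    and n: "c * real n = M * ln (1 + M / d)"
begin

private lemma M_pos: "M > 0"
  using M d by (meson divide_pos_pos less_le_trans zero_less_one)

private lemma dM: "1 \<le> d * M"
  using M d by (simp add: divide_simps mult.commute)

private lemma ratio: "1 \<le> M / d"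
proof -
  have "1 \<le> 1 / d" using d by simp
  then have "1 \<le> M" using M by linarith
  then show ?thesis using d by simp
qed

text \<open>The logarithm is at least ln 2, hence at least 1/2, and M is at least 1/d. This lets
  errors of order 1/n be absorbed into d.\<close>

private lemma n_ge: "1 / (2 * d) \<le> real n"
proof -
  have "ln (1 / 2) \<le> 1 / 2 - (1::real)" by (rule ln_le_minus_one) simp
  then have "1 / 2 \<le> ln (2::real)" by (simp add: ln_div)
  also have "\<dots> \<le> ln (1 + M / d)" using ratio by simp
  finally have "1 / d * (1 / 2) \<le> M * ln (1 + M / d)"
    using M M_pos d by (intro mult_mono) auto
  also have "\<dots> = c * real n" using n by simp
  also have "\<dots> \<le> real n" using c by (simp add: mult_left_le_one_le)
  finally show ?thesis by simp
qed

private lemma n_pos: "real n > 0"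
proof -
  have "0 < 1 / (2 * d)" using d by simp
  then show ?thesis using n_ge by linarith
qed

text \<open>The inward shift c/M of the contour stays within the scale d.\<close>

private lemma M_le_d: "c / M \<le> d"
proof -
  have "c / M \<le> 1 / M" using c M_pos by (intro divide_right_mono) auto
  also have "\<dots> \<le> d" using dM M_pos by (simp add: divide_simps)
  finally show ?thesis .
qed

text \<open>The perturbation starts at the point of the unit circle with the same angle: distance at
  most c/M times resolvent norm at most M is at most c, and c < 1.\<close>

private lemma far_arc:
  assumes s: "- (c / M) \<le> s" "s \<le> 0" and t: "\<theta> \<in> {d..2 * pi - d}"
  shows "exp (Complex s \<theta>) \<notin> \<sigma>" "norm (R (exp (Complex s \<theta>))) \<le> M / (1 - c)"
proof -
  have r: "cis \<theta> \<notin> \<sigma>" "norm (R (cis \<theta>)) \<le> M" using res [OF t] by auto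
  have "exp s \<le> 1" using s by simp
  then have "\<bar>exp s - 1\<bar> \<le> c / M" using s exp_ge_add_one_self [of s] by linarith
  then have "cmod (exp (Complex s \<theta>) - cis \<theta>) * norm (R (cis \<theta>)) \<le> c / M * M"
    unfolding cmod_exp_Complex_minus_cis using r c M_pos by (intro mult_mono) auto
  then have *: "cmod (exp (Complex s \<theta>) - cis \<theta>) * norm (R (cis \<theta>)) \<le> c"
    using M_pos by simp
  show "exp (Complex s \<theta>) \<notin> \<sigma>"
    by (rule resolvent_perturbation(1) [OF J T r(1) * c(2)])
  have "norm (R (exp (Complex s \<theta>))) \<le> norm (R (cis \<theta>)) / (1 - c)"
    by (rule resolvent_perturbation(2) [OF J T r(1) * c(2)])
  also have "\<dots> \<le> M / (1 - c)" using r c by (intro divide_right_mono) auto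
  finally show "norm (R (exp (Complex s \<theta>))) \<le> M / (1 - c)" .
qed

private lemma far_domain:
  assumes s: "- (c / M) \<le> s" and t: "\<theta> \<in> {d..2 * pi - d}"
  shows "exp (Complex s \<theta>) \<in> - \<sigma> - {1}"
proof -
  have "exp (Complex s \<theta>) \<noteq> 1"
    using cmod_exp_Complex_minus_one_ge_angle [OF d t, of s] d by auto
  moreover have "exp (Complex s \<theta>) \<notin> \<sigma>"
  proof (cases "s \<le> 0")
    case False
    then show ?thesis by (intro resolvent_outside_disc(1) [OF J T K]) simp
  qed (rule far_arc [OF s _ t])
  ultimately show ?thesis by blast
qed

private lemma norm_analytic_le:
  assumes s: "s \<le> 0"
  shows "norm (analytic_integrand d n (exp (Complex s \<theta>)))
      \<le> cmod (newman_weight d (exp (Complex s \<theta>))) * exp (real n * s) * norm ((id_blinfun - T) o\<^sub>L R (exp (Complex s \<theta>)))"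
    (is "_ \<le> ?w * _ * ?N")
proof -
  have "norm (analytic_integrand d n (exp (Complex s \<theta>))) \<le> ?w * exp s * exp s ^ n * ?N"
    unfolding analytic_integrand_def
    by (rule order_trans [OF norm_cscaleL_compose_le [OF J]]) (simp add: norm_mult norm_power)
  also have "\<dots> \<le> ?w * 1 * exp s ^ n * ?N"
    using s by (intro mult_right_mono mult_left_mono) auto
  finally show ?thesis by (simp add: exp_of_nat_mult)
qed

text \<open>Three factors: the weight is at most 6|s|/d, the operator (I - T)R is at most 3dM', and
  |s| exp(ns) is at most 1/n. The powers of d cancel.\<close>

private lemma analytic_leg:
  assumes s: "- (c / M) \<le> s" "s \<le> 0" and t: "\<bar>\<theta>\<bar> = d"
  shows "norm (analytic_integrand d n (exp (Complex s \<theta>))) \<le> 18 * (M / (1 - c)) / real n"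
proof -
  define z where "z = exp (Complex s \<theta>)"
  define M' where "M' = M / (1 - c)"
  have z: "z \<notin> \<sigma>" "norm (R z) \<le> M'"
  proof -
    consider "\<theta> = d" | "\<theta> = - d" using t by linarith
    then have "z = exp (Complex s d) \<or> z = exp (Complex s (2 * pi - d))"
      using exp_Complex_2pi [of s "- d"] by cases (simp_all add: z_def add.commute)
    moreover have "d \<in> {d..2 * pi - d}" "2 * pi - d \<in> {d..2 * pi - d}" using d pi_gt3 by auto
    ultimately show "z \<notin> \<sigma>" "norm (R z) \<le> M'" using far_arc [OF s] unfolding M'_def by auto
  qed
  have "M * (1 - c) \<le> M" using c M_pos by (intro mult_right_le_one_le) auto
  then have "M \<le> M'" using c by (simp add: M'_def divide_simps mult.commute)
  \<comment> \<open>Used to absorb the term I of (I - T)R = I - (z - 1)R: 1 + 2dM' is at most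
    3dM'.\<close>
  then have dM': "1 \<le> d * M'" using dM d by (meson mult_left_mono order.trans less_imp_le)
  have "exp s \<le> 1" using s by simp
  then have es: "\<bar>exp s - 1\<bar> \<le> - s" using exp_ge_add_one_self [of s] by linarith
  have "cmod (z - 1) \<le> \<bar>exp s - 1\<bar> + d"
    using cmod_exp_Complex_minus_one_le [of s \<theta>] t by (simp add: z_def)
  then have zd: "cmod (z - 1) \<le> 2 * d" using es s M_le_d by linarith
  have "norm ((id_blinfun - T) o\<^sub>L R z) \<le> norm (id_blinfun :: 'a \<Rightarrow>\<^sub>L 'a) + norm (cscaleL J (z - 1) o\<^sub>L R z)"
    unfolding id_minus_compose_resolvent [OF T z(1)] by (rule norm_triangle_ineq4)
  also have "\<dots> \<le> 1 + 2 * d * M'"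
    using z zd d by (intro add_mono norm_blinfun_id_le order_trans [OF norm_cscaleL_compose_le [OF J]] mult_mono) auto
  also have "\<dots> \<le> 3 * d * M'" using dM' by linarith
  finally have N: "norm ((id_blinfun - T) o\<^sub>L R z) \<le> 3 * d * M'" .
  have w: "cmod (newman_weight d z) \<le> 6 * (- s) / d"
  proof -
    have "cmod (newman_weight d z) \<le> 6 * \<bar>exp s - 1\<bar> / d"
      unfolding z_def by (rule newman_weight_leg [OF d t])
    also have "\<dots> \<le> 6 * (- s) / d" using es d by (intro divide_right_mono mult_left_mono) auto
    finally show ?thesis .
  qed
  have w0: "0 \<le> 6 * (- s) / d" using s d by (intro divide_nonneg_pos) auto
  \<comment> \<open>From x at most exp x at x = -ns.\<close>
  have e: "- s * exp (real n * s) \<le> 1 / real n"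
  proof -
    have "real n * (- s) \<le> exp (real n * (- s))"
      using exp_ge_add_one_self [of "real n * (- s)"] by linarith
    then have "real n * (- s) * exp (real n * s) \<le> exp (real n * (- s)) * exp (real n * s)"
      by (intro mult_right_mono) auto
    also have "\<dots> = 1" by (simp flip: exp_add)
    finally show ?thesis using n_pos by (simp add: divide_simps mult.commute mult.left_commute)
  qed
  have "norm (analytic_integrand d n z) \<le> cmod (newman_weight d z) * exp (real n * s) * norm ((id_blinfun - T) o\<^sub>L R z)"
    unfolding z_def by (rule norm_analytic_le [OF s(2)])
  also have "\<dots> \<le> (6 * (- s) / d) * exp (real n * s) * (3 * d * M')"
    by (intro mult_mono mult_nonneg_nonneg w N w0 norm_ge_zero exp_ge_zero order_refl)
  also have "\<dots> = 18 * M' * (- s * exp (real n * s))" using d by (simp add: field_simps)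
  also have "\<dots> \<le> 18 * M' * (1 / real n)"
    using e \<open>M \<le> M'\<close> M_pos by (intro mult_left_mono) auto
  finally show ?thesis by (simp add: z_def M'_def)
qed

text \<open>This is where the logarithm in \<open>m_log\<close> is spent: the decay of |z|^n on the
  shifted arc is at most d/M, which cancels the resolvent bound M/(1 - c) up to a multiple of
  d.\<close>

private lemma analytic_far:
  assumes t: "\<theta> \<in> {d..2 * pi - d}"
  shows "norm (analytic_integrand d n (exp (Complex (- (c / M)) \<theta>))) \<le> 9 * (1 + K) * d / (1 - c)"
proof -
  define z where "z = exp (Complex (- (c / M)) \<theta>)"
  have s: "- (c / M) \<le> 0" using c M_pos by simp
  have Rz: "norm (R z) \<le> M / (1 - c)" unfolding z_def by (rule far_arc [OF order_refl s t])
  have "d / 2 \<le> cmod (z - 1)" unfolding z_def by (rule cmod_exp_Complex_minus_one_ge_angle [OF d t])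
  then have w: "cmod (newman_weight d z) \<le> 9" by (rule newman_weight_bounds(1) [OF d(1)])
  have "real n * (- (c / M)) = - ln (1 + M / d)" using n M_pos by (simp add: field_simps)
  then have "exp (real n * (- (c / M))) = inverse (1 + M / d)" using ratio by (simp add: exp_minus)
  also have "\<dots> \<le> d / M" using ratio M_pos d by (simp add: divide_simps)
  finally have e: "exp (real n * (- (c / M))) \<le> d / M" .
  have "norm ((id_blinfun - T) o\<^sub>L R z) \<le> norm (id_blinfun - T) * norm (R z)"
    by (rule norm_blinfun_compose)
  also have "\<dots> \<le> (1 + K) * (M / (1 - c))"
    using Rz K1 T_le norm_id_blinfun_diff_le [of T] by (intro mult_mono) auto
  finally have N: "norm ((id_blinfun - T) o\<^sub>L R z) \<le> (1 + K) * (M / (1 - c))" .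
  have "norm (analytic_integrand d n z) \<le> cmod (newman_weight d z) * exp (real n * (- (c / M))) * norm ((id_blinfun - T) o\<^sub>L R z)"
    unfolding z_def by (rule norm_analytic_le [OF s])
  also have "\<dots> \<le> 9 * (d / M) * ((1 + K) * (M / (1 - c)))"
    using w e N d M_pos by (intro mult_mono) auto
  also have "\<dots> = 9 * (1 + K) * d / (1 - c)" using M_pos c by (simp add: divide_simps)
  finally show ?thesis by (simp add: z_def)
qed

text \<open>The upper end of the far arc lies on the ray at angle -d, so the leg bounds for
  \<open>\<bar>\<theta>\<bar> = d\<close> apply at both ends.\<close>

private lemma exp_Complex_leg: "exp (Complex s (2 * pi - d)) = exp (Complex s (- d))"
  using exp_Complex_2pi [of s "- d"] by (simp add: add.commute)

text \<open>In the constant, 1728 = 8 * 216: the two near arcs of angle 2d and the two pairs of legs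
  of logarithmic length d contribute 2d each, times 216 K^2. The other terms come from the legs and
  the shifted arc of the part with z^n.\<close>

lemma norm_op_pow_id_minus_le:
  "2 * pi * norm (X n) \<le> (1728 * K\<^sup>2 + 72 / (1 - c) + 18 * pi * (1 + K) / (1 - c)) * d"
proof -
  let ?B = "216 * K\<^sup>2" and ?\<alpha> = d and ?\<beta> = "2 * pi - d"
  let ?u = "outer_integrand d n" and ?g = "analytic_integrand d n" and ?v = "inner_integrand d n"
  define h where "h = c / M"
  have h: "0 < h" using c M_pos by (simp add: h_def)
  have ab: "?\<alpha> \<le> ?\<beta>" using d pi_gt3 by linarith
  have dd: "- d \<le> d" using d by simp
  note dom = far_domain [folded h_def]
  have outer_dom: "exp (Complex d \<theta>) \<in> - \<sigma> - {1}" for \<theta>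
    using resolvent_outside_disc(1) [OF J T K, of "exp (Complex d \<theta>)"] d
      cmod_exp_Complex_minus_one_ge [of d \<theta>] by auto
  have inner_dom: "exp (Complex (- d) \<theta>) \<in> - {1}" for \<theta>
    using cmod_exp_Complex_minus_one_ge [of "- d" \<theta>] d by auto

  \<comment> \<open>The outer circle splits into the near arc 2 and the far arc, which 3 moves to the unit circle.
    There 4 splits the integrand; 5 and 6 dispose of the polynomial part, 7 and 8 of the part with \<open>z\<^sup>n\<close>.\<close>
  have 1: "(2 * pi) *\<^sub>R X n = arc_integral ?u d (- d) d + arc_integral ?u d ?\<alpha> ?\<beta>"
    using outer_circle [OF d(1), of d n "- d"]
      arc_integral_combine [OF outer_holomorphic [of d n] outer_dom dd ab]
    by simp
  have 2: "norm (arc_integral ?u d (- d) d) \<le> ?B * (2 * d)"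
  proof -
    have "norm (?u (exp (Complex d \<theta>)) - 0) \<le> ?B" if "\<theta> \<in> {- d..d}" for \<theta>
      using outer_bound [OF d, of d \<theta> n] that by (auto simp: abs_le_iff)
    from norm_arc_integral_le [OF outer_holomorphic outer_dom dd this] show ?thesis by simp
  qed
  have 3: "norm (arc_integral ?u d ?\<alpha> ?\<beta> - arc_integral ?u 0 ?\<alpha> ?\<beta>) \<le> (2 * ?B) * (d - 0)"
  proof (rule cauchy_arcs [OF J outer_holomorphic _ ab])
    fix s assume "s \<in> {0..d}"
    then show "norm (?u (exp (Complex s ?\<beta>)) - ?u (exp (Complex s ?\<alpha>))) \<le> 2 * ?B"
      unfolding exp_Complex_leg
      using norm_triangle_ineq4 [of "?u (exp (Complex s (- d)))" "?u (exp (Complex s d))"]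
        outer_bound [OF d, of s d n] outer_bound [OF d, of s "- d" n] by auto
  next
    fix s \<theta> assume "s \<in> {0..d}" "\<theta> \<in> {?\<alpha>..?\<beta>}"
    then show "exp (Complex s \<theta>) \<in> - \<sigma> - {1}" using dom [of s \<theta>] h by simp
  qed (use d in auto)
  have 4: "arc_integral ?u 0 ?\<alpha> ?\<beta> = arc_integral ?g 0 ?\<alpha> ?\<beta> - arc_integral ?v 0 ?\<alpha> ?\<beta>"
  proof -
    have dom0: "exp (Complex 0 \<theta>) \<in> - \<sigma> - {1}" if "\<theta> \<in> {?\<alpha>..?\<beta>}" for \<theta>
      using dom [of 0 \<theta>] h that by simp
    have "arc_integral ?u 0 ?\<alpha> ?\<beta> = integral {?\<alpha>..?\<beta>} (\<lambda>\<theta>. ?g (exp (Complex 0 \<theta>)) - ?v (exp (Complex 0 \<theta>)))"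
      unfolding arc_integral_def using dom0 by (intro integral_cong outer_eq) blast
    also have "\<dots> = arc_integral ?g 0 ?\<alpha> ?\<beta> - arc_integral ?v 0 ?\<alpha> ?\<beta>"
      unfolding arc_integral_def
      using dom0 by (intro Henstock_Kurzweil_Integration.integral_diff integrable_continuous_interval
          continuous_on_arc [OF analytic_holomorphic] continuous_on_arc [OF inner_holomorphic]) blast+
    finally show ?thesis .
  qed
  have 5: "norm (arc_integral ?v 0 ?\<alpha> ?\<beta> - arc_integral ?v (- d) ?\<alpha> ?\<beta>) \<le> (2 * ?B) * (0 - (- d))"
  proof (rule cauchy_arcs [OF J inner_holomorphic _ ab])
    fix s assume "s \<in> {- d..0}"
    then show "norm (?v (exp (Complex s ?\<beta>)) - ?v (exp (Complex s ?\<alpha>))) \<le> 2 * ?B"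
      unfolding exp_Complex_leg
      using norm_triangle_ineq4 [of "?v (exp (Complex s (- d)))" "?v (exp (Complex s d))"]
        inner_bound [OF d, of s d n] inner_bound [OF d, of s "- d" n] by auto
  next
    fix s \<theta> assume "\<theta> \<in> {?\<alpha>..?\<beta>}"
    then show "exp (Complex s \<theta>) \<in> - {1}"
      using cmod_exp_Complex_minus_one_ge_angle [OF d, of \<theta> s] d by auto
  qed (use d in auto)
  have 6: "norm (arc_integral ?v (- d) ?\<alpha> ?\<beta>) \<le> ?B * (2 * d)"
  proof -
    \<comment> \<open>The inner integral over the full circle vanishes, so the far arc can be traded
      for the short near arc.\<close>
    have "arc_integral ?v (- d) (- d) d + arc_integral ?v (- d) ?\<alpha> ?\<beta> = 0"
      using inner_circle [of "- d" d n "- d"] d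
        arc_integral_combine [OF inner_holomorphic [of d n] inner_dom dd ab]
      by simp
    then have "norm (arc_integral ?v (- d) ?\<alpha> ?\<beta>) = norm (arc_integral ?v (- d) (- d) d)"
      by (metis add_eq_0_iff norm_minus_cancel)
    also have "\<dots> \<le> ?B * (2 * d)"
    proof -
      have "norm (?v (exp (Complex (- d) \<theta>)) - 0) \<le> ?B" if "\<theta> \<in> {- d..d}" for \<theta>
        using inner_bound [OF d, of "- d" \<theta> n] that by (auto simp: abs_le_iff)
      from norm_arc_integral_le [OF inner_holomorphic inner_dom dd this] show ?thesis by simp
    qed
    finally show ?thesis .
  qed
  have 7: "norm (arc_integral ?g 0 ?\<alpha> ?\<beta> - arc_integral ?g (- h) ?\<alpha> ?\<beta>) \<le> 72 / (1 - c) * d"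
  proof -
    define E where "E = 18 * (M / (1 - c)) / real n"
    have "norm (arc_integral ?g 0 ?\<alpha> ?\<beta> - arc_integral ?g (- h) ?\<alpha> ?\<beta>) \<le> (2 * E) * (0 - (- h))"
    proof (rule cauchy_arcs [OF J analytic_holomorphic _ ab])
      fix s assume "s \<in> {- h..0}"
      then show "norm (?g (exp (Complex s ?\<beta>)) - ?g (exp (Complex s ?\<alpha>))) \<le> 2 * E"
        unfolding exp_Complex_leg
        using norm_triangle_ineq4 [of "?g (exp (Complex s (- d)))" "?g (exp (Complex s d))"]
          analytic_leg [of s d] analytic_leg [of s "- d"] d by (auto simp: h_def E_def)
    next
      fix s \<theta> assume "s \<in> {- h..0}" "\<theta> \<in> {?\<alpha>..?\<beta>}"
      then show "exp (Complex s \<theta>) \<in> - \<sigma> - {1}" using dom [of s \<theta>] by simp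
    qed (use h in auto)
    \<comment> \<open>The length c/M of the legs cancels the factor M of their bound, leaving order
      1/n, which \<open>n_ge\<close> turns into d.\<close>
    also have "\<dots> = 36 / (1 - c) * (c / real n)"
      using M_pos c n_pos by (simp add: E_def h_def field_simps)
    also have "\<dots> \<le> 36 / (1 - c) * (2 * d)"
    proof (intro mult_left_mono)
      have "c / real n \<le> 1 / real n" using c by (intro divide_right_mono) auto
      also have "\<dots> \<le> 2 * d" using n_ge n_pos d by (simp add: divide_simps mult.commute)
      finally show "c / real n \<le> 2 * d" .
    qed (use c in auto)
    finally show ?thesis by simp
  qed
  have 8: "norm (arc_integral ?g (- h) ?\<alpha> ?\<beta>) \<le> 18 * pi * (1 + K) / (1 - c) * d"
  proof -
    have "norm (arc_integral ?g (- h) ?\<alpha> ?\<beta> - (?\<beta> - ?\<alpha>) *\<^sub>R 0) \<le> 9 * (1 + K) * d / (1 - c) * (?\<beta> - ?\<alpha>)"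
    proof (rule norm_arc_integral_le [OF analytic_holomorphic _ ab])
      fix \<theta> assume t: "\<theta> \<in> {?\<alpha>..?\<beta>}"
      show "exp (Complex (- h) \<theta>) \<in> - \<sigma> - {1}" using dom [of "- h" \<theta>] t by simp
      show "norm (?g (exp (Complex (- h) \<theta>)) - 0) \<le> 9 * (1 + K) * d / (1 - c)"
        using analytic_far [OF t] by (simp add: h_def)
    qed
    also have "\<dots> \<le> 9 * (1 + K) * d / (1 - c) * (2 * pi)"
      using d c K1 by (intro mult_left_mono) auto
    finally show ?thesis by (simp add: mult_ac)
  qed
  have triangle: "norm (A\<^sub>1 + A\<^sub>2 + A\<^sub>3 + A\<^sub>4 - A\<^sub>5 - A\<^sub>6)
      \<le> norm A\<^sub>1 + norm A\<^sub>2 + norm A\<^sub>3 + norm A\<^sub>4 + norm A\<^sub>5 + norm A\<^sub>6"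
    for A\<^sub>1 A\<^sub>2 A\<^sub>3 A\<^sub>4 A\<^sub>5 A\<^sub>6 :: "'a \<Rightarrow>\<^sub>L 'a"
    by norm
  have "(2 * pi) *\<^sub>R X n = arc_integral ?u d (- d) d
      + (arc_integral ?u d ?\<alpha> ?\<beta> - arc_integral ?u 0 ?\<alpha> ?\<beta>)
      + (arc_integral ?g 0 ?\<alpha> ?\<beta> - arc_integral ?g (- h) ?\<alpha> ?\<beta>) + arc_integral ?g (- h) ?\<alpha> ?\<beta>
      - (arc_integral ?v 0 ?\<alpha> ?\<beta> - arc_integral ?v (- d) ?\<alpha> ?\<beta>) - arc_integral ?v (- d) ?\<alpha> ?\<beta>"
    using 1 4 by simp
  then have "norm ((2 * pi) *\<^sub>R X n) \<le> ?B * (2 * d) + (2 * ?B) * (d - 0) + 72 / (1 - c) * d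
      + 18 * pi * (1 + K) / (1 - c) * d + (2 * ?B) * (0 - (- d)) + ?B * (2 * d)"
    by (simp only:) (use 2 3 5 6 7 8 in \<open>intro order_trans [OF triangle] add_mono\<close>)
  then show ?thesis by (simp add: algebra_simps)
qed

end

end

subsection \<open>The inverse function and the rate of decay\<close>

text \<open>\<open>m\<close> may be constant on intervals; strictness comes from the division by
  \<theta> inside the logarithm.\<close>

lemma m_log_strict_decreasing:
  assumes pos: "\<forall>\<theta>\<in>{0<..pi}. m \<theta> > 0"
    and dec: "\<forall>x\<in>{0<..pi}. \<forall>y\<in>{0<..pi}. x \<le> y \<longrightarrow> m y \<le> m x"
    and xy: "0 < x" "x < y" "y \<le> pi"
  shows "m_log m y < m_log m x"
proof -
  have m: "m x > 0" "m y > 0" "m y \<le> m x" using pos dec xy by auto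
  have "m y / y < m x / x"
    using m xy by (meson divide_strict_left_mono divide_right_mono mult_pos_pos le_less_trans less_imp_le less_trans)
  then have "ln (1 + m y / y) < ln (1 + m x / x)"
    using m xy by (subst ln_less_cancel_iff) (auto intro!: add_pos_pos divide_pos_pos)
  moreover have "0 < ln (1 + m y / y)" using m xy by (intro ln_gt_zero) (auto intro!: divide_pos_pos)
  ultimately show ?thesis
    unfolding m_log_def using m by (intro mult_le_less_imp_less) auto
qed

text \<open>Existence is the intermediate value theorem on some [x, 1], as \<open>lower\<close>
  makes \<open>m_log m\<close> unbounded near 0; strict monotonicity on (0, pi] makes the
  description in \<open>m_log_inv\<close> unique.\<close>

lemma m_log_inv_properties:
  assumes pos: "\<forall>\<theta>\<in>{0<..pi}. m \<theta> > 0"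
    and dec: "\<forall>x\<in>{0<..pi}. \<forall>y\<in>{0<..pi}. x \<le> y \<longrightarrow> m y \<le> m x"
    and cont: "continuous_on {0<..pi} m"
    and lower: "\<And>x. 0 < x \<Longrightarrow> x \<le> 1 \<Longrightarrow> 1 / x \<le> m x"
    and y: "m_log m 1 \<le> y"
  shows "0 < m_log_inv m y" "m_log_inv m y \<le> 1" "m_log m (m_log_inv m y) = y"
proof -
  have pi1: "1 \<le> pi" using pi_gt3 by linarith
  have ge: "1 / (2 * x) \<le> m_log m x" if x: "0 < x" "x \<le> 1" for x
  proof -
    have "ln (1 / 2) \<le> 1 / 2 - (1::real)" by (rule ln_le_minus_one) simp
    then have "1 / 2 \<le> ln (2::real)" by (simp add: ln_div)
    also have "\<dots> \<le> ln (1 + m x / x)"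
    proof -
      have "x \<le> 1 / x" using x by (simp add: divide_simps mult_le_one)
      then have "1 \<le> m x / x" using lower [OF x] x by simp
      then show ?thesis by simp
    qed
    finally have "1 / x * (1 / 2) \<le> m x * ln (1 + m x / x)"
      using lower [OF x] x pi1 pos by (intro mult_mono) (auto intro: less_imp_le)
    then show ?thesis by (simp add: m_log_def)
  qed
  have y0: "y > 0" using ge [of 1] y by simp
  \<comment> \<open>Solves 1/(2x) at least y, so that \<open>ge\<close> brackets y between the
    values of \<open>m_log m\<close> at 1 and at x.\<close>
  define x where "x = min 1 (1 / (2 * y))"
  have x: "0 < x" "x \<le> 1" using y0 by (auto simp: x_def)
  have "y \<le> 1 / (2 * x)" using y0 x by (simp add: x_def divide_simps min_def split: if_splits)
  with ge [OF x] have yx: "y \<le> m_log m x" by linarith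
  have mc: "continuous_on {x..1} m" by (rule continuous_on_subset [OF cont]) (use x pi1 in auto)
  have nz: "1 + m t / t \<noteq> 0" if "t \<in> {x..1}" for t
  proof -
    have "0 < m t / t" using pos that x pi1 by (intro divide_pos_pos) auto
    then show ?thesis by linarith
  qed
  have "continuous_on {x..1} (m_log m)"
    unfolding m_log_def by (intro continuous_intros mc) (use nz x in auto)
  from IVT2' [OF y yx x(2) this] obtain t where t: "x \<le> t" "t \<le> 1" "m_log m t = y" by blast
  have "m_log_inv m y = t"
    unfolding m_log_inv_def
  proof (rule the_equality)
    fix u assume u: "u \<in> {0<..pi} \<and> m_log m u = y"
    show "u = t"
      using m_log_strict_decreasing [OF pos dec, of u t] m_log_strict_decreasing [OF pos dec, of t u] u t x pi1
      by (cases u t rule: linorder_cases) auto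
  qed (use t x pi1 in auto)
  then show "0 < m_log_inv m y" "m_log_inv m y \<le> 1" "m_log m (m_log_inv m y) = y"
    using t x by auto
qed

theorem theorem2p11:
  fixes J T :: "'a::banach \<Rightarrow>\<^sub>L 'a" and m :: "real \<Rightarrow> real" and c :: real
  assumes "complex_structure J"
    and "clinear_op J T"
    and "power_bounded T"
    and "op_spectrum J T \<inter> sphere 0 1 = {1}"
    and "continuous_on {0<..pi} m"
    and "\<forall>\<theta>\<in>{0<..pi}. m \<theta> > 0"
    and "\<forall>x\<in>{0<..pi}. \<forall>y\<in>{0<..pi}. x \<le> y \<longrightarrow> m y \<le> m x"
    and "\<forall>\<theta>. 0 < \<bar>\<theta>\<bar> \<and> \<bar>\<theta>\<bar> \<le> pi \<longrightarrow> norm (resolvent J (cis \<theta>) T) \<le> m \<bar>\<theta>\<bar>"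
    and "0 < c" and "c < 1"
  shows "(\<lambda>n. norm (op_pow T n o\<^sub>L (id_blinfun - T))) \<in> O(\<lambda>n. m_log_inv m (c * real n))"
proof -
  note J = assms(1) and T = assms(2) and spec = assms(4) and pos = assms(6) and dec = assms(7) and bd = assms(8)
  obtain C where C: "\<And>n. norm (op_pow T n) \<le> C"
    using assms(3) unfolding power_bounded_def by blast
  \<comment> \<open>The locale requires a constant of at least 1, so that K and 1 can be absorbed
    into K^2.\<close>
  define K where "K = max 1 C"
  interpret power_bounded_operator J T K
  proof
    show "norm (op_pow T n) \<le> K" for n
      unfolding K_def using C by (rule max.coboundedI2)
  qed (simp_all add: J T K_def)
  have regular: "cis \<theta> \<notin> \<sigma>" "norm (R (cis \<theta>)) \<le> m \<bar>\<theta>\<bar>" if t: "0 < \<bar>\<theta>\<bar>" "\<bar>\<theta>\<bar> \<le> pi" for \<theta>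
  proof -
    have "cis \<theta> \<noteq> 1"
    proof
      assume "cis \<theta> = 1"
      then have "cos \<bar>\<theta>\<bar> = 1" by (simp add: complex_eq_iff)
      then show False using cos_monotone_0_pi [of 0 "\<bar>\<theta>\<bar>"] t by simp
    qed
    moreover have "cis \<theta> \<in> sphere 0 1" by simp
    ultimately show "cis \<theta> \<notin> \<sigma>" using spec by blast
    show "norm (R (cis \<theta>)) \<le> m \<bar>\<theta>\<bar>" using bd t by blast
  qed
  \<comment> \<open>Since 1 is in the spectrum, perturbation from cis x must not reach it: |1 - cis
    x| times the resolvent norm is at least 1, while |1 - cis x| is at most x.\<close>
  have lower: "1 / x \<le> m x" if x: "0 < x" "x \<le> 1" for x
  proof (rule ccontr)
    assume "\<not> 1 / x \<le> m x"
    then have lt: "x * m x < 1" using x by (simp add: divide_simps mult.commute)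
    have xpi: "0 < \<bar>x\<bar>" "\<bar>x\<bar> \<le> pi" using x pi_gt3 by auto
    have "cmod (1 - cis x) * norm (R (cis x)) \<le> x * m x"
      using regular(2) [OF xpi] cmod_cis_minus_one_le [of x] x
      by (intro mult_mono) (auto simp: norm_minus_commute)
    then have "1 \<notin> \<sigma>" using resolvent_perturbation(1) [OF J T regular(1) [OF xpi] _ lt] by blast
    then show False using spec by blast
  qed
  define B where "B = (1728 * K\<^sup>2 + 72 / (1 - c) + 18 * pi * (1 + K) / (1 - c)) / (2 * pi)"
  have "norm (norm (X n)) \<le> B * norm (m_log_inv m (c * real n))" if n: "m_log m 1 \<le> c * real n" for n
  proof -
    define d where "d = m_log_inv m (c * real n)"
    have d: "0 < d" "d \<le> 1" "m_log m d = c * real n"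
      unfolding d_def using m_log_inv_properties [OF pos dec assms(5) lower n] by auto
    have "cis \<theta> \<notin> \<sigma> \<and> norm (R (cis \<theta>)) \<le> m d" if t: "\<theta> \<in> {d..2 * pi - d}" for \<theta>
    proof (cases "\<theta> \<le> pi")
      case True
      then have "0 < \<bar>\<theta>\<bar>" "\<bar>\<theta>\<bar> \<le> pi" "m \<bar>\<theta>\<bar> \<le> m d" using t d dec by auto
      then show ?thesis using regular [of \<theta>] by auto
    next
      case False
      \<comment> \<open>The resolvent hypothesis covers angles up to pi only; after reduction
        \<open>\<bar>\<phi>\<bar>\<close> is still at least d, so monotonicity of \<open>m\<close>
        gives the bound \<open>m d\<close>.\<close>
      define \<phi> where "\<phi> = \<theta> - 2 * pi"
      have "0 < \<bar>\<phi>\<bar>" "\<bar>\<phi>\<bar> \<le> pi" "m \<bar>\<phi>\<bar> \<le> m d" using False t d dec pi_gt3 by (auto simp: \<phi>_def)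
      moreover have "cis \<phi> = cis \<theta>" by (simp add: \<phi>_def complex_eq_iff cos_diff sin_diff)
      ultimately show ?thesis using regular [of \<phi>] by auto
    qed
    from norm_op_pow_id_minus_le [OF assms(9,10) d(1,2) lower [OF d(1,2)] this]
    have "2 * pi * norm (X n) \<le> (2 * pi * B) * d"
      using d(3) by (simp add: m_log_def B_def)
    then have "2 * pi * norm (X n) \<le> 2 * pi * (B * d)" by (simp only: mult.assoc)
    then have "norm (X n) \<le> B * d" by simp
    then show ?thesis using d by (simp add: d_def)
  qed
  \<comment> \<open>Only from here on is c n known to lie in the range of \<open>m_log m\<close>,
    with inverse at most 1.\<close>
  moreover have "\<forall>\<^sub>F n in sequentially. m_log m 1 \<le> c * real n"
  proof -
    obtain N :: nat where N: "m_log m 1 / c \<le> real N" using real_arch_simple by blast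
    have "m_log m 1 \<le> c * real n" if "N \<le> n" for n
    proof -
      have "m_log m 1 / c \<le> real n" using N that by linarith
      then show ?thesis using assms(9) by (simp add: divide_simps mult.commute)
    qed
    then show ?thesis unfolding eventually_sequentially by blast
  qed
  ultimately show ?thesis
    by (intro bigoI [where c = B]) (auto elim: eventually_mono)
qed

end
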